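(* Let $n\ge 1$. The functional $P_{\mathcal L}(\phi)=\int_{\mathbb R^n}e^{-\phi(x)}dx\int_{\mathbb R^n}e^{-\mathcal L\phi(x)}dx$ achieves a minimum on the set of even functions in $\mathrm{Cvx}^+(\mathbb R^n)$. Moreover, $P_{\mathcal L}$ achieves a minimum on the set of functions in $\mathrm{Cvx}^+(\mathbb R^n)$ whose centroid is $0$.
   Context: $\mathrm{Cvx}(\mathbb R^n)$ is the set of closed (lower semi-continuous) proper convex functions $\phi:\mathbb R^n\to\mathbb R\cup\{\infty\}$, and $\mathrm{Cvx}^+(\mathbb R^n)=\{\phi\in\mathrm{Cvx}(\mathbb R^n):0<\int_{\mathbb R^n}e^{-\phi(x)}dx<\infty\}$ (with $e^{-\infty}=0$). The Legendre transform is $\mathcal L\phi(y)=\sup_{x\in\mathbb R^n}\{\langle x,y\rangle-\phi(x)\}$. The centroid of $\phi$ is $c(\phi)=\frac{\int_{\mathbb R^n}xe^{-\phi(x)}dx}{\int_{\mathbb R^n}e^{-\phi(x)}dx}$. A function $\phi$ is even if $\phi(-x)=\phi(x)$ for all $x$. *)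

theory Defs
  imports "HOL-Analysis.Analysis"
begin

definition lower_semicontinuous :: "('a::topological_space \<Rightarrow> ereal) \<Rightarrow> bool" where
  "lower_semicontinuous \<phi> \<longleftrightarrow> (\<forall>x. \<phi> x \<le> Liminf (at x) \<phi>)"

definition proper_fun :: "('a \<Rightarrow> ereal) \<Rightarrow> bool" where
  "proper_fun \<phi> \<longleftrightarrow> (\<forall>x. \<phi> x \<noteq> -\<infinity>) \<and> (\<exists>x. \<phi> x \<noteq> \<infinity>)"

text \<open>
  Extended-real counterpart of \<^const>\<open>convex_on\<close> on the whole space. The multiplication of
  \<^typ>\<open>ereal\<close> satisfies \<open>0 * \<infinity> = 0\<close>, so the end points \<open>u = 0\<close> and \<open>v = 0\<close> give no
  condition. The definition is only used for functions that never take the value \<open>-\<infinity>\<close>.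
\<close>

definition ereal_convex :: "('a::real_vector \<Rightarrow> ereal) \<Rightarrow> bool" where
  "ereal_convex \<phi> \<longleftrightarrow>
     (\<forall>x y. \<forall>u\<ge>0. \<forall>v\<ge>0. u + v = 1 \<longrightarrow>
        \<phi> (u *\<^sub>R x + v *\<^sub>R y) \<le> ereal u * \<phi> x + ereal v * \<phi> y)"

definition Cvx :: "(real ^ 'n::finite \<Rightarrow> ereal) set" where
  "Cvx = {\<phi>. lower_semicontinuous \<phi> \<and> proper_fun \<phi> \<and> ereal_convex \<phi>}"

function exp_neg :: "ereal \<Rightarrow> ennreal" where
  "exp_neg (ereal r) = ennreal (exp (- r))"
| "exp_neg \<infinity> = 0"
| "exp_neg (-\<infinity>) = \<infinity>"
  by (auto intro: ereal_cases)
termination by standard (rule wf_on_bot)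

text \<open>
  The integrals of \<open>exp (- \<phi>)\<close> are taken in \<^typ>\<open>ennreal\<close>, because the integral of
  \<open>exp (- \<L> \<phi>)\<close> may be infinite for a general integrable \<open>\<phi>\<close>.
\<close>

definition exp_integral :: "(real ^ 'n::finite \<Rightarrow> ereal) \<Rightarrow> ennreal" where
  "exp_integral \<phi> = (\<integral>\<^sup>+ x. exp_neg (\<phi> x) \<partial>lborel)"

definition Cvx_plus :: "(real ^ 'n::finite \<Rightarrow> ereal) set" where
  "Cvx_plus = {\<phi> \<in> Cvx. 0 < exp_integral \<phi> \<and> exp_integral \<phi> < \<infinity>}"

definition legendre :: "(real ^ 'n::finite \<Rightarrow> ereal) \<Rightarrow> real ^ 'n \<Rightarrow> ereal" where
  "legendre \<phi> y = (SUP x. ereal (x \<bullet> y) - \<phi> x)"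

text \<open>
  For \<open>\<phi>\<close> in \<open>Cvx_plus\<close> the function \<open>exp (- \<phi>)\<close> is real-valued, log-concave and integrable,
  hence decays exponentially; the vector-valued Bochner integral below then converges, and
  \<^const>\<open>enn2real\<close> loses nothing.
\<close>

definition centroid :: "(real ^ 'n::finite \<Rightarrow> ereal) \<Rightarrow> real ^ 'n" where
  "centroid \<phi> = (\<integral> x. enn2real (exp_neg (\<phi> x)) *\<^sub>R x \<partial>lborel) /\<^sub>R enn2real (exp_integral \<phi>)"

definition even_fun :: "(real ^ 'n::finite \<Rightarrow> ereal) \<Rightarrow> bool" where
  "even_fun \<phi> \<longleftrightarrow> (\<forall>x. \<phi> (- x) = \<phi> x)"

definition P_legendre :: "(real ^ 'n::finite \<Rightarrow> ereal) \<Rightarrow> ennreal" where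
  "P_legendre \<phi> = exp_integral \<phi> * exp_integral (legendre \<phi>)"

definition attains_min_on :: "('a \<Rightarrow> 'b::order) \<Rightarrow> 'a set \<Rightarrow> bool" where
  "attains_min_on F S \<longleftrightarrow> (\<exists>x\<in>S. \<forall>y\<in>S. F x \<le> F y)"

end

theory Submission
  imports Defs "HOL-Library.Diagonal_Subsequence"
begin

text \<open>
  The proof is the direct method. The functional \<open>P_legendre\<close> does not change when a function is
  composed with an invertible linear map or shifted by a constant, so a minimizing sequence can first
  be moved into a compact position (\<open>normalized_affine_change\<close>). Even functions in
  \<open>Cvx_plus\<close> have centroid \<open>0\<close>, and therefore one argument serves both classes.

  The centroid condition enters through \<open>centroid_value_le\<close>. By Jensen's inequality, the value at
  the origin is at most the mean of \<open>\<phi>\<close> with respect to the density \<open>exp (- \<phi>)\<close>, and a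
  dilation argument (\<open>entropy_bound\<close>) bounds this mean by the infimum of \<open>\<phi>\<close> plus a constant that
  depends on the dimension only. So the sublevel set one unit above the value at the origin contains
  the origin, and \<open>\<phi>\<close> is not much smaller anywhere else. Points of this set that span a maximal
  volume (\<open>max_volume_frame\<close>) become the unit vectors after a linear map, which places the set
  between the standard simplex and a cube. Convexity then gives, uniformly for the sequence, an upper
  bound on a fixed ball and a lower bound with linear growth.

  For the limit, epi-convergence is used. Every sequence has an epi-convergent subsequence
  (\<open>epi_compactness\<close>), and epi-limits inherit convexity, lower semicontinuity and evenness. For
  convex functions with a common bound on a ball, epi-convergence implies pointwise convergence off
  the frontier of a convex set (\<open>epi_converges_pointwise\<close>). Hence dominated convergence applies to
  the integral of \<open>exp (- \<phi>)\<close> and to its first moment, so the limit has a finite positive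
  integral and centroid \<open>0\<close>. Asymptotically, the Legendre transforms are not larger than the
  transform of the limit (\<open>epi_converges_legendre\<close>), again off the frontier of a convex set, so that Fatou's
  lemma bounds the integral of \<open>exp (- \<L> \<phi>)\<close> of the limit by the lower limit of the
  integrals. The product at the limit is therefore at most the infimum.
\<close>

section \<open>The weight and lower semicontinuous convex functions\<close>

lemma exp_neg_antimono: "x \<le> y \<Longrightarrow> exp_neg y \<le> exp_neg x"
  by (cases x; cases y) auto

lemma exp_neg_surj: "surj exp_neg"
proof -
  have "\<exists>x. exp_neg x = y" for y
  proof (cases y)
    case (real r)
    show ?thesis
    proof (cases "r = 0")
      case True
      then show ?thesis using real by (intro exI[of _ "\<infinity>"]) simp
    next
      case False
      then show ?thesis using real by (intro exI[of _ "ereal (- ln r)"]) simp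
    qed
  next
    case top
    then show ?thesis by (intro exI[of _ "-\<infinity>"]) (simp add: infinity_ennreal_def)
  qed
  then show ?thesis by (metis surj_def)
qed

lemma continuous_exp_neg: "continuous_on UNIV exp_neg"
proof -
  have "range (\<lambda>x. exp_neg (- x)) = UNIV"
    using exp_neg_surj by (metis (mono_tags, lifting) UNIV_I ereal_uminus_uminus surj_def)
  then have "continuous_on UNIV (\<lambda>x. exp_neg (- x))"
    by (intro continuous_onI_mono) (auto intro: exp_neg_antimono)
  then have "continuous_on UNIV ((\<lambda>x. exp_neg (- x)) \<circ> uminus)"
    by (intro continuous_on_compose) (auto intro: continuous_on_subset continuous_uminus_ereal)
  then show ?thesis by (simp add: o_def)
qed

lemma tendsto_exp_neg: "(f \<longlongrightarrow> l) F \<Longrightarrow> ((\<lambda>x. exp_neg (f x)) \<longlongrightarrow> exp_neg l) F"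
  using continuous_exp_neg continuous_on_tendsto_compose[of UNIV exp_neg f l F] by simp

lemma measurable_exp_neg [measurable]: "exp_neg \<in> borel \<rightarrow>\<^sub>M borel"
  using borel_measurable_continuous_onI[OF continuous_exp_neg] .

lemma exp_neg_shift: "exp_neg (x + ereal c) = ennreal (exp (- c)) * exp_neg x"
  by (cases x) (auto simp: ennreal_mult[symmetric] exp_add[symmetric] ennreal_mult_top algebra_simps infinity_ennreal_def)

lemma exp_neg_less_top: "x \<noteq> -\<infinity> \<Longrightarrow> exp_neg x < \<infinity>"
  by (cases x) auto

lemma exp_neg_le_real: "ereal r \<le> x \<Longrightarrow> exp_neg x \<le> ennreal (exp (- r))"
  using exp_neg_antimono[of "ereal r" x] by simp

text \<open>
  Openness of the strict superlevel sets is the form of lower semicontinuity that passes to suprema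
  and gives Borel measurability.
\<close>

lemma lsc_iff_open: "lower_semicontinuous \<phi> \<longleftrightarrow> (\<forall>t. open {x. t < \<phi> x})"
proof
  assume l: "lower_semicontinuous \<phi>"
  show "\<forall>t. open {x. t < \<phi> x}"
  proof
    fix t
    show "open {x. t < \<phi> x}"
    proof (subst open_subopen, safe)
      fix x assume t: "t < \<phi> x"
      then have "\<forall>y<\<phi> x. eventually (\<lambda>z. y < \<phi> z) (at x)"
        using l unfolding lower_semicontinuous_def le_Liminf_iff by blast
      then have "eventually (\<lambda>z. t < \<phi> z) (at x)" using t by blast
      then have "eventually (\<lambda>z. t < \<phi> z) (nhds x)"
        using t by (simp add: eventually_nhds_conv_at)
      then obtain S where "open S" "x \<in> S" "\<forall>z\<in>S. t < \<phi> z"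
        by (auto simp: eventually_nhds)
      then show "\<exists>T. open T \<and> x \<in> T \<and> T \<subseteq> {x. t < \<phi> x}" by blast
    qed
  qed
next
  assume o: "\<forall>t. open {x. t < \<phi> x}"
  show "lower_semicontinuous \<phi>"
    unfolding lower_semicontinuous_def le_Liminf_iff
  proof safe
    fix x y assume "y < \<phi> x"
    then have "\<exists>S. open S \<and> x \<in> S \<and> (\<forall>z\<in>S. y < \<phi> z)"
      using o by (intro exI[of _ "{z. y < \<phi> z}"]) auto
    then show "\<forall>\<^sub>F z in at x. y < \<phi> z" by (meson eventually_at_topological)
  qed
qed

lemma lsc_closed_sublevel: "lower_semicontinuous \<phi> \<Longrightarrow> closed {x. \<phi> x \<le> t}"
  unfolding lsc_iff_open closed_def by (simp add: Collect_neg_eq[symmetric] not_le)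

lemma lsc_measurable: "lower_semicontinuous \<phi> \<Longrightarrow> \<phi> \<in> borel_measurable borel"
  unfolding lsc_iff_open by (intro borel_measurableI_greater) auto

text \<open>
  Finite upper bounds in place of values turn convexity of an extended-real function into
  arithmetic of real numbers. This lemma and its converse below carry all later uses of convexity.
\<close>

lemma ereal_convexD:
  assumes "ereal_convex \<phi>" "\<phi> x \<le> ereal s" "\<phi> y \<le> ereal t" "u \<ge> 0" "v \<ge> 0" "u + v = 1"
  shows "\<phi> (u *\<^sub>R x + v *\<^sub>R y) \<le> ereal (u * s + v * t)"
proof -
  have "\<phi> (u *\<^sub>R x + v *\<^sub>R y) \<le> ereal u * \<phi> x + ereal v * \<phi> y"
    using assms unfolding ereal_convex_def by blast
  also have "\<dots> \<le> ereal u * ereal s + ereal v * ereal t"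
    by (intro add_mono ereal_mult_left_mono) (use assms in auto)
  finally show ?thesis by simp
qed

lemma ereal_convexI:
  assumes "\<And>x. \<phi> x \<noteq> -\<infinity>"
    and *: "\<And>x y s t u v. \<phi> x < ereal s \<Longrightarrow> \<phi> y < ereal t \<Longrightarrow> u > 0 \<Longrightarrow> v > 0 \<Longrightarrow> u + v = 1
       \<Longrightarrow> \<phi> (u *\<^sub>R x + v *\<^sub>R y) \<le> ereal (u * s + v * t)"
  shows "ereal_convex \<phi>"
  unfolding ereal_convex_def
proof safe
  fix x y and u v :: real
  assume uv: "u \<ge> 0" "v \<ge> 0" "u + v = 1"
  show "\<phi> (u *\<^sub>R x + v *\<^sub>R y) \<le> ereal u * \<phi> x + ereal v * \<phi> y"
  proof (cases "u = 0 \<or> v = 0")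
    case True
    then show ?thesis using uv by (auto simp flip: zero_ereal_def)
  next
    case False
    then have uv': "u > 0" "v > 0" using uv by auto
    show ?thesis
    proof (cases "\<phi> x = \<infinity> \<or> \<phi> y = \<infinity>")
      case True
      then have "ereal u * \<phi> x + ereal v * \<phi> y = \<infinity>"
        using uv' assms(1)[of x] assms(1)[of y] by (cases "\<phi> x"; cases "\<phi> y") auto
      then show ?thesis by (metis ereal_less_eq(1))
    next
      case False
      then obtain a b where ab: "\<phi> x = ereal a" "\<phi> y = ereal b"
        using assms(1)[of x] assms(1)[of y] by (cases "\<phi> x"; cases "\<phi> y") auto
      have "\<phi> (u *\<^sub>R x + v *\<^sub>R y) \<le> ereal (u * a + v * b) + ereal e" if "e > 0" for e
      proof -
        have "\<phi> (u *\<^sub>R x + v *\<^sub>R y) \<le> ereal (u * (a + e) + v * (b + e))"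
          by (rule *) (use ab that uv' uv in auto)
        also have "u * (a + e) + v * (b + e) = u * a + v * b + (u + v) * e" by (simp add: algebra_simps)
        finally show ?thesis using uv by simp
      qed
      then have "\<phi> (u *\<^sub>R x + v *\<^sub>R y) \<le> ereal (u * a + v * b)"
        by (blast intro: ereal_le_epsilon2)
      then show ?thesis by (simp add: ab)
    qed
  qed
qed

lemma ereal_convex_sublevel: "ereal_convex \<phi> \<Longrightarrow> convex {x. \<phi> x \<le> ereal t}"
  unfolding convex_def
proof safe
  fix x y and u v :: real
  assume "ereal_convex \<phi>" "\<phi> x \<le> ereal t" "\<phi> y \<le> ereal t" "0 \<le> u" "0 \<le> v" "u + v = 1"
  from ereal_convexD[OF this] this(6) show "\<phi> (u *\<^sub>R x + v *\<^sub>R y) \<le> ereal t"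
    by (simp add: distrib_right[symmetric])
qed

lemma ereal_less_infinity_iff: "(x::ereal) < \<infinity> \<longleftrightarrow> (\<exists>t. x \<le> ereal t)"
  by (cases x) auto

lemma ereal_convex_domain: "ereal_convex \<phi> \<Longrightarrow> convex {x. \<phi> x < \<infinity>}"
  unfolding convex_def ereal_less_infinity_iff by (blast dest: ereal_convexD)

lemma Cvx_measurable: "\<phi> \<in> Cvx \<Longrightarrow> \<phi> \<in> borel_measurable borel"
  by (auto simp: Cvx_def intro: lsc_measurable)

section \<open>Linear changes of variables in Lebesgue integrals\<close>

lemma measurable_matrix_vector [measurable]: "(*v) A \<in> borel \<rightarrow>\<^sub>M borel" for A :: "real^'n^'m"
  by (intro borel_measurable_continuous_onI) (simp add: linear_continuous_on)

lemma matrix_shear_apply: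
  fixes x :: "real^'n"
  assumes "m \<noteq> n"
  shows "(\<chi> i j. of_bool (i = m \<and> j = n \<or> i = j)) *v x = (\<chi> i. if i = m then x$m + x$n else x$i)"
proof -
  have "(\<Sum>j\<in>UNIV. of_bool (i = m \<and> j = n \<or> i = j) * x $ j) = (if i = m then x $ m + x $ n else x $ i)" for i
  proof -
  have "(\<Sum>j\<in>UNIV. of_bool (i = m \<and> j = n \<or> i = j) * x $ j)
      = (\<Sum>j\<in>UNIV. (if j = i then x $ j else 0) + (if i = m then if j = n then x $ j else 0 else 0))"
    using assms by (intro sum.cong) auto
  also have "\<dots> = x $ i + (if i = m then x $ n else 0)"
    by (simp add: sum.distrib)
  finally show ?thesis by auto
  qed
  then show ?thesis by (simp add: vec_eq_iff matrix_vector_mult_def)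
qed

lemma det_shear:
  assumes "m \<noteq> n"
  shows "det (\<chi> i j. of_bool (i = m \<and> j = n \<or> i = j) :: real^'n^'n) = 1"
proof -
  have "(\<chi> i j. of_bool (i = m \<and> j = n \<or> i = j) :: real^'n^'n)
      = (\<chi> k. if k = m then row m (mat 1) + 1 *s row n (mat 1) else row k (mat 1))"
    using assms by (auto simp: vec_eq_iff row_def mat_def)
  then show ?thesis using det_row_operation[OF assms, of "mat 1 :: real^'n^'n" 1] by (simp only: det_I)
qed

text \<open>
  Translating the box in the direction of the coordinate that is added makes that coordinate
  nonnegative on the box, which is what \<open>measure_shear_interval\<close> asks for; a linear map
  takes translates to translates, so volumes do not change.
\<close>

lemma emeasure_shear_vimage_box:
  fixes l u :: "real^'n"
  assumes "m \<noteq> n"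
  defines "h \<equiv> (\<lambda>x::real^'n. \<chi> i. if i = m then x$m + x$n else x$i)"
  shows "emeasure lborel (h -` box l u) = emeasure lborel (box l u)"
proof -
  have lin: "linear h"
    unfolding h_def by (rule linearI) (auto simp: algebra_simps plus_vec_def scaleR_vec_def vec_eq_iff)
  have inj: "inj h"
  proof (rule injI)
    fix x y assume "h x = h y"
    then have eq: "h x $ i = h y $ i" for i by simp
    have "x $ i = y $ i" for i
      using eq[of i] eq[of n] assms(1) by (auto simp: h_def split: if_splits)
    then show "x = y" by (simp add: vec_eq_iff)
  qed
  have surj: "surj h"
    using lin inj linear_injective_imp_surjective by blast
  have box: "measure lebesgue (h ` cbox a b) = 1 * measure lebesgue (cbox a b)" for a b
  proof (cases "cbox a b = {}")
    case False
    define v :: "real^'n" where "v = axis n (a $ n)"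
    have "h ` cbox a b = h ` (+) v ` cbox (a - v) (b - v)"
      by (simp flip: cbox_translation)
    also have "\<dots> = (+) (h v) ` h ` cbox (a - v) (b - v)"
      by (auto simp: image_image linear_add[OF lin])
    finally have "measure lebesgue (h ` cbox a b) = measure lebesgue (h ` cbox (a - v) (b - v))"
      by (simp add: measure_translation)
    also have "\<dots> = measure lebesgue (cbox (a - v) (b - v))"
      unfolding h_def
    proof (rule measure_shear_interval[OF assms(1)])
      show "cbox (a - v) (b - v) \<noteq> {}"
        using False cbox_translation[of v "a - v" "b - v"] by auto
      show "0 \<le> (a - v) $ n" by (simp add: v_def)
    qed
    also have "\<dots> = measure lebesgue ((+) v ` cbox (a - v) (b - v))"
      by (simp only: measure_translation)
    also have "\<dots> = measure lebesgue (cbox a b)"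
      by (simp flip: cbox_translation)
    finally show ?thesis by simp
  qed simp
  have "bounded (h -` box l u)"
  proof -
    obtain g where g: "linear g" "g \<circ> h = id"
      using linear_injective_left_inverse[OF lin inj] by blast
    have "h -` box l u \<subseteq> g ` box l u"
    proof
      fix x assume "x \<in> h -` box l u"
      moreover have "g (h x) = x" using g(2) by (metis comp_apply id_apply)
      ultimately show "x \<in> g ` box l u" by (metis image_eqI vimageD)
    qed
    moreover have "bounded (g ` box l u)"
      using bounded_linear_image[OF bounded_box] g(1) linear_linear by blast
    ultimately show ?thesis by (rule bounded_subset[rotated])
  qed
  moreover have o: "open (h -` box l u)"
    using open_vimage[OF open_box] lin linear_continuous_on linear_linear by blast
  ultimately have lm: "h -` box l u \<in> lmeasurable"
    by (rule lmeasurable_open)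
  have im: "h ` (h -` box l u) = box l u"
    using surj by (simp add: surj_image_vimage_eq)
  from measure_linear_sufficient[OF lin lm box]
  have eq: "measure lebesgue (h -` box l u) = measure lebesgue (box l u)"
    unfolding im by simp
  have "emeasure lebesgue (h -` box l u) = emeasure lebesgue (box l u)"
    using lm lmeasurable_box[of l u] eq by (simp only: emeasure_eq_measure2)
  then show ?thesis using o by simp
qed

lemma nn_integral_linear_of_box:
  fixes A :: "real^'n^'n"
  assumes box: "\<And>l u. (\<And>i. l $ i \<le> u $ i) \<Longrightarrow> emeasure lborel ((*v) A -` box l u) = emeasure lborel (box l u)"
    and "f \<in> borel_measurable borel"
  shows "(\<integral>\<^sup>+x. f (A *v x) \<partial>lborel) = (\<integral>\<^sup>+x. f x \<partial>lborel)"
proof -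
  have "lborel = distr lborel borel ((*v) A)"
  proof (rule lborel_eqI)
    fix l u :: "real^'n" assume le: "\<And>b. b \<in> Basis \<Longrightarrow> l \<bullet> b \<le> u \<bullet> b"
    then have "l $ i \<le> u $ i" for i
      using le[of "axis i 1"] by (simp add: inner_axis axis_in_Basis_iff)
    from box[OF this]
    show "emeasure (distr lborel borel ((*v) A)) (box l u) = (\<Prod>b\<in>Basis. (u - l) \<bullet> b)"
      using le by (simp add: emeasure_distr)
  qed simp
  then have "(\<integral>\<^sup>+x. f x \<partial>lborel) = (\<integral>\<^sup>+x. f x \<partial>distr lborel borel ((*v) A))" by simp
  also have "\<dots> = (\<integral>\<^sup>+x. f (A *v x) \<partial>lborel)"
    by (rule nn_integral_distr) (use assms in auto)
  finally show ?thesis by simp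
qed

text \<open>
  Both sides are multiplicative in the matrix, so elementary matrices suffice. Shears and
  permutations preserve the volume of boxes and have determinant \<open>1\<close> or \<open>- 1\<close>; a diagonal
  matrix is a coordinatewise dilation.
\<close>

lemma nn_integral_linear_matrix:
  fixes A :: "real^'n^'n" and f :: "real^'n \<Rightarrow> ennreal"
  assumes "det A \<noteq> 0" "f \<in> borel_measurable borel"
  shows "ennreal \<bar>det A\<bar> * (\<integral>\<^sup>+x. f (A *v x) \<partial>lborel) = (\<integral>\<^sup>+x. f x \<partial>lborel)"
proof -
  define P where "P = (\<lambda>A::real^'n^'n. det A \<noteq> 0 \<longrightarrow> (\<forall>f\<in>borel_measurable borel.
      ennreal \<bar>det A\<bar> * (\<integral>\<^sup>+x. f (A *v x) \<partial>lborel) = (\<integral>\<^sup>+x. f x \<partial>lborel)))"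
  have "P A"
  proof (rule induct_matrix_elementary_alt)
    fix A B :: "real^'n^'n"
    assume A: "P A" and B: "P B"
    show "P (A ** B)"
      unfolding P_def
    proof (intro impI ballI)
      fix f :: "real^'n \<Rightarrow> ennreal" assume d: "det (A ** B) \<noteq> 0" and f: "f \<in> borel_measurable borel"
      have mA: "(\<lambda>x. f (A *v x)) \<in> borel_measurable borel" by (rule measurable_compose[OF measurable_matrix_vector f])
      have d': "det A \<noteq> 0" "det B \<noteq> 0" using d by (auto simp: det_mul)
      have "ennreal \<bar>det (A ** B)\<bar> * (\<integral>\<^sup>+x. f ((A ** B) *v x) \<partial>lborel)
          = ennreal \<bar>det A\<bar> * (ennreal \<bar>det B\<bar> * (\<integral>\<^sup>+x. f (A *v (B *v x)) \<partial>lborel))"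
        by (simp add: det_mul abs_mult ennreal_mult mult.assoc matrix_vector_mul_assoc)
      also have "\<dots> = ennreal \<bar>det A\<bar> * (\<integral>\<^sup>+x. f (A *v x) \<partial>lborel)"
        using B[unfolded P_def, rule_format, OF d'(2) mA] by simp
      also have "\<dots> = (\<integral>\<^sup>+x. f x \<partial>lborel)" using A d' f unfolding P_def by simp
      finally show "ennreal \<bar>det (A ** B)\<bar> * (\<integral>\<^sup>+x. f ((A ** B) *v x) \<partial>lborel) = (\<integral>\<^sup>+x. f x \<partial>lborel)" .
    qed
  next
    fix A :: "real^'n^'n" and i assume "row i A = 0"
    then show "P A" unfolding P_def using det_zero_row(2) by blast
  next
    fix A :: "real^'n^'n" assume diag: "\<And>i j. i \<noteq> j \<Longrightarrow> A $ i $ j = 0"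
    show "P A" unfolding P_def
    proof (intro impI ballI)
      fix f :: "real^'n \<Rightarrow> ennreal" assume d: "det A \<noteq> 0" and [measurable]: "f \<in> borel_measurable borel"
      have det: "det A = (\<Prod>i\<in>UNIV. A $ i $ i)" by (rule det_diagonal) (rule diag)
      define c :: "real^'n \<Rightarrow> real" where "c = (\<lambda>b. b \<bullet> (A *v b))"
      have c_axis: "c (axis i 1) = A $ i $ i" for i
        by (simp add: c_def inner_axis' matrix_vector_mult_basis column_def)
      have Basis: "Basis = range (\<lambda>i. axis i 1 :: real^'n)" by (auto simp: Basis_vec_def)
      have inj: "inj (\<lambda>i. axis i 1 :: real^'n)" by (auto simp: inj_def axis_eq_axis)
      have c0: "c b \<noteq> 0" if "b \<in> Basis" for b
        using that d unfolding Basis det by (auto simp: c_axis)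
      have pc: "(\<Prod>b\<in>Basis. \<bar>c b\<bar>) = \<bar>det A\<bar>"
        unfolding Basis det using inj by (simp add: prod.reindex c_axis abs_prod)
      have T: "0 + (\<Sum>j\<in>Basis. (c j * (x \<bullet> j)) *\<^sub>R j) = A *v x" for x
      proof -
        have 1: "(\<Sum>j\<in>Basis. (c j * (x \<bullet> j)) *\<^sub>R j) = (\<Sum>j\<in>UNIV. (A $ j $ j * x $ j) *\<^sub>R axis j 1)"
          unfolding Basis using inj by (simp add: sum.reindex c_axis inner_axis)
        have 2: "(\<Sum>j\<in>UNIV. (A $ j $ j * x $ j) *\<^sub>R axis j 1) $ i = (A *v x) $ i" for i
        proof -
          have "(\<Sum>j\<in>UNIV. (A $ j $ j * x $ j) *\<^sub>R axis j 1) $ i = (\<Sum>j\<in>UNIV. if j = i then A $ j $ j * x $ j else 0)"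
            unfolding sum_component by (rule sum.cong) (auto simp: axis_def)
          also have "\<dots> = A $ i $ i * x $ i" by simp
          also have "\<dots> = (\<Sum>j\<in>UNIV. if j = i then A $ i $ j * x $ j else 0)" by simp
          also have "\<dots> = (A *v x) $ i"
            unfolding matrix_vector_mult_def vec_lambda_beta by (rule sum.cong) (auto simp: diag)
          finally show ?thesis .
        qed
        show ?thesis unfolding 1 by (simp add: vec_eq_iff 2 del: sum_component)
      qed
      have "lborel = density (distr lborel borel ((*v) A)) (\<lambda>_. ennreal \<bar>det A\<bar>)"
        using lborel_affine_euclidean[where c=c and t=0, OF c0] unfolding T pc by simp
      then have "(\<integral>\<^sup>+x. f x \<partial>lborel) = (\<integral>\<^sup>+x. f x \<partial>density (distr lborel borel ((*v) A)) (\<lambda>_. ennreal \<bar>det A\<bar>))"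
        by simp
      also have "\<dots> = (\<integral>\<^sup>+x. ennreal \<bar>det A\<bar> * f (A *v x) \<partial>lborel)"
        by (simp add: nn_integral_density nn_integral_distr)
      also have "\<dots> = ennreal \<bar>det A\<bar> * (\<integral>\<^sup>+x. f (A *v x) \<partial>lborel)"
        by (rule nn_integral_cmult) measurable
      finally show "ennreal \<bar>det A\<bar> * (\<integral>\<^sup>+x. f (A *v x) \<partial>lborel) = (\<integral>\<^sup>+x. f x \<partial>lborel)" by simp
    qed
  next
    fix m n :: 'n assume "m \<noteq> n"
    let ?t = "Transposition.transpose m n"
    let ?S = "\<chi> i j. mat 1 $ i $ ?t j :: real^'n^'n"
    have ap: "(?S *v x) $ i = x $ ?t i" for x i
    proof -
      have "(?S *v x) $ i = (\<Sum>j\<in>UNIV. if j = ?t i then x $ j else 0)"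
        unfolding matrix_vector_mult_def mat_def vec_lambda_beta
        by (rule sum.cong) (auto simp: transpose_eq_iff)
      then show ?thesis by simp
    qed
    have det: "\<bar>det ?S\<bar> = 1"
      by (simp add: det_permute_columns permutes_swap_id sign_swap_id abs_mult)
    show "P ?S" unfolding P_def
    proof (intro impI ballI)
      fix f :: "real^'n \<Rightarrow> ennreal" assume f: "f \<in> borel_measurable borel"
      have "(\<integral>\<^sup>+x. f (?S *v x) \<partial>lborel) = (\<integral>\<^sup>+x. f x \<partial>lborel)"
      proof (rule nn_integral_linear_of_box[OF _ f])
        fix l u :: "real^'n" assume le: "\<And>i. l $ i \<le> u $ i"
        have "(*v) ?S -` box l u = box (\<chi> i. l $ ?t i) (\<chi> i. u $ ?t i)"
        proof (rule set_eqI)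
          fix x
          have "x \<in> (*v) ?S -` box l u \<longleftrightarrow> (\<forall>i. l $ i < x $ ?t i \<and> x $ ?t i < u $ i)"
            by (simp add: mem_box_cart ap)
          also have "\<dots> \<longleftrightarrow> (\<forall>i. l $ ?t i < x $ i \<and> x $ i < u $ ?t i)"
            using transpose_involutory[of m n] by metis
          finally show "x \<in> (*v) ?S -` box l u \<longleftrightarrow> x \<in> box (\<chi> i. l $ ?t i) (\<chi> i. u $ ?t i)"
            by (simp add: mem_box_cart)
        qed
        moreover have "emeasure lborel (box a b) = ennreal (\<Prod>i\<in>UNIV. b $ i - a $ i)"
          if "\<And>i. a $ i \<le> b $ i" for a b :: "real^'n"
        proof -
          have Basis: "Basis = range (\<lambda>i. axis i 1 :: real^'n)" by (auto simp: Basis_vec_def)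
          have inj: "inj (\<lambda>i. axis i 1 :: real^'n)" by (auto simp: inj_def axis_eq_axis)
          have "emeasure lborel (box a b) = ennreal (\<Prod>j\<in>Basis. (b - a) \<bullet> j)"
            by (rule emeasure_lborel_box) (auto simp: Basis inner_axis that)
          then show ?thesis unfolding Basis using inj by (simp add: prod.reindex inner_axis)
        qed
        moreover have "(\<Prod>i\<in>UNIV. u $ ?t i - l $ ?t i) = (\<Prod>i\<in>UNIV. u $ i - l $ i)"
          by (rule prod.reindex_bij_betw) simp
        ultimately show "emeasure lborel ((*v) ?S -` box l u) = emeasure lborel (box l u)"
          using le by simp
      qed
      then show "ennreal \<bar>det ?S\<bar> * (\<integral>\<^sup>+x. f (?S *v x) \<partial>lborel) = (\<integral>\<^sup>+x. f x \<partial>lborel)"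
        using det by simp
    qed
  next
    fix m n :: 'n assume mn: "m \<noteq> n"
    let ?S = "\<chi> i j. of_bool (i = m \<and> j = n \<or> i = j) :: real^'n^'n"
    show "P ?S" unfolding P_def
    proof (intro impI ballI)
      fix f :: "real^'n \<Rightarrow> ennreal" assume f: "f \<in> borel_measurable borel"
      have S: "(*v) ?S = (\<lambda>x. \<chi> i. if i = m then x$m + x$n else x$i)"
        by (rule ext) (rule matrix_shear_apply[OF mn])
      have "(\<integral>\<^sup>+x. f (?S *v x) \<partial>lborel) = (\<integral>\<^sup>+x. f x \<partial>lborel)"
        by (rule nn_integral_linear_of_box[OF _ f]) (simp only: S emeasure_shear_vimage_box[OF mn])
      then show "ennreal \<bar>det ?S\<bar> * (\<integral>\<^sup>+x. f (?S *v x) \<partial>lborel) = (\<integral>\<^sup>+x. f x \<partial>lborel)"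
        using det_shear[OF mn] by simp
    qed
  qed
  then show ?thesis using assms unfolding P_def by blast
qed

section \<open>The Legendre transform and the symmetries of the functional\<close>

text \<open>
  An upper bound for the Legendre transform is the same as an affine minorant, so that
  later arguments about the supremum become arguments about inequalities between real bounds.
\<close>

lemma legendre_le_iff: "legendre \<phi> y \<le> ereal s \<longleftrightarrow> (\<forall>x. ereal (x \<bullet> y - s) \<le> \<phi> x)"
proof -
  have "ereal (x \<bullet> y) - \<phi> x \<le> ereal s \<longleftrightarrow> ereal (x \<bullet> y - s) \<le> \<phi> x" for x
    by (cases "\<phi> x") auto
  then show ?thesis by (simp add: legendre_def SUP_le_iff)
qed

lemma legendre_lsc: "lower_semicontinuous (legendre \<phi>)"
  unfolding lsc_iff_open
proof
  fix t
  have "open {y. t < ereal (x \<bullet> y) - \<phi> x}" for x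
  proof (cases "\<phi> x")
    case (real r)
    have "open ((\<lambda>y. ereal (x \<bullet> y - r)) -` {t<..})"
      by (intro open_vimage continuous_intros)
    then show ?thesis using real by (simp add: vimage_def)
  qed auto
  then have "open (\<Union>x. {y. t < ereal (x \<bullet> y) - \<phi> x})" by blast
  also have "(\<Union>x. {y. t < ereal (x \<bullet> y) - \<phi> x}) = {y. t < legendre \<phi> y}"
    by (auto simp: legendre_def less_SUP_iff)
  finally show "open {y. t < legendre \<phi> y}" .
qed

lemma legendre_domain_convex: "convex {y. legendre \<phi> y < \<infinity>}"
  unfolding convex_def
proof safe
  fix y z and u v :: real
  assume yz: "legendre \<phi> y < \<infinity>" "legendre \<phi> z < \<infinity>" and uv: "0 \<le> u" "0 \<le> v" "u + v = 1"
  obtain s t where st: "legendre \<phi> y \<le> ereal s" "legendre \<phi> z \<le> ereal t"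
    using yz unfolding ereal_less_infinity_iff by blast
  have "ereal (x \<bullet> (u *\<^sub>R y + v *\<^sub>R z) - (u * s + v * t)) \<le> \<phi> x" for x
  proof -
    have "x \<bullet> (u *\<^sub>R y + v *\<^sub>R z) - (u * s + v * t) = u * (x \<bullet> y - s) + v * (x \<bullet> z - t)"
      by (simp add: algebra_simps)
    also have "\<dots> \<le> max (x \<bullet> y - s) (x \<bullet> z - t)"
      by (rule convex_bound_le) (use uv in auto)
    finally have "ereal (x \<bullet> (u *\<^sub>R y + v *\<^sub>R z) - (u * s + v * t)) \<le> max (ereal (x \<bullet> y - s)) (ereal (x \<bullet> z - t))"
      by (simp add: ereal_max[symmetric] del: ereal_max)
    also have "\<dots> \<le> \<phi> x" using st unfolding legendre_le_iff by simp
    finally show ?thesis .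
  qed
  then show "legendre \<phi> (u *\<^sub>R y + v *\<^sub>R z) < \<infinity>"
    unfolding ereal_less_infinity_iff legendre_le_iff by blast
qed

text \<open>
  The symmetries of the problem: composition with an invertible matrix multiplies one of the two
  integrals in \<open>P_legendre\<close> by \<open>1 / \<bar>det A\<bar>\<close> and the other one by \<open>\<bar>det A\<bar>\<close>, and addition
  of a constant multiplies them by \<open>exp (- c)\<close> and \<open>exp c\<close>.
\<close>

definition affine_change :: "real^'n^'n \<Rightarrow> real \<Rightarrow> (real^'n \<Rightarrow> ereal) \<Rightarrow> real^'n \<Rightarrow> ereal" where
  "affine_change A c \<phi> x = \<phi> (A *v x) + ereal c"

lemma affine_change_Cvx:
  assumes "\<phi> \<in> Cvx" "invertible A"
  shows "affine_change A c \<phi> \<in> Cvx"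
proof -
  obtain B where B: "A ** B = mat 1" using assms(2) invertible_def by blast
  have l: "lower_semicontinuous \<phi>" and cv: "ereal_convex \<phi>" and p1: "\<And>x. \<phi> x \<noteq> -\<infinity>"
    and p2: "\<exists>x. \<phi> x \<noteq> \<infinity>"
    using assms(1) by (auto simp: Cvx_def proper_fun_def)
  have "open {x. t < affine_change A c \<phi> x}" for t
  proof -
    have "t < \<phi> (A *v x) + ereal c \<longleftrightarrow> t - ereal c < \<phi> (A *v x)" for x
      by (cases t; cases "\<phi> (A *v x)") auto
    then have "{x. t < affine_change A c \<phi> x} = (*v) A -` {x. t - ereal c < \<phi> x}"
      by (auto simp: affine_change_def)
    moreover have "open \<dots>"
      using l unfolding lsc_iff_open by (intro open_vimage) (auto intro: linear_continuous_on)
    ultimately show ?thesis by simp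
  qed
  then have 1: "lower_semicontinuous (affine_change A c \<phi>)" by (simp add: lsc_iff_open)
  have p1': "affine_change A c \<phi> x \<noteq> -\<infinity>" for x
    using p1[of "A *v x"] by (cases "\<phi> (A *v x)") (auto simp: affine_change_def)
  obtain x where "\<phi> x \<noteq> \<infinity>" using p2 by blast
  moreover have "A *v (B *v x) = x" by (simp add: matrix_vector_mul_assoc B)
  ultimately have "affine_change A c \<phi> (B *v x) \<noteq> \<infinity>" by (simp add: affine_change_def)
  then have 2: "proper_fun (affine_change A c \<phi>)" using p1' by (auto simp: proper_fun_def)
  have "ereal_convex (affine_change A c \<phi>)"
  proof (rule ereal_convexI[OF p1'])
    fix x y s t and u v :: real
    assume s: "affine_change A c \<phi> x < ereal s" "affine_change A c \<phi> y < ereal t" and uv: "u > 0" "v > 0" "u + v = 1"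
    have "\<phi> (A *v x) \<le> ereal (s - c)" "\<phi> (A *v y) \<le> ereal (t - c)"
      using s by (cases "\<phi> (A *v x)"; cases "\<phi> (A *v y)"; simp add: affine_change_def)+
    from ereal_convexD[OF cv this, of u v] uv
    have "\<phi> (u *\<^sub>R (A *v x) + v *\<^sub>R (A *v y)) \<le> ereal (u * (s - c) + v * (t - c))" by simp
    also have "u * (s - c) + v * (t - c) = u * s + v * t - (u + v) * c" by (simp add: algebra_simps)
    finally have "\<phi> (A *v (u *\<^sub>R x + v *\<^sub>R y)) \<le> ereal (u * s + v * t - c)"
      using uv by (simp add: matrix_vector_right_distrib matrix_vector_mult_scaleR)
    then show "affine_change A c \<phi> (u *\<^sub>R x + v *\<^sub>R y) \<le> ereal (u * s + v * t)"
      unfolding affine_change_def by (cases "\<phi> (A *v (u *\<^sub>R x + v *\<^sub>R y))") auto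
  qed
  with 1 2 show ?thesis by (simp add: Cvx_def)
qed

lemma exp_integral_affine_change:
  fixes A :: "real^'n^'n"
  assumes "det A \<noteq> 0" "\<phi> \<in> borel_measurable borel"
  shows "exp_integral (affine_change A c \<phi>) = ennreal (exp (- c) / \<bar>det A\<bar>) * exp_integral \<phi>"
proof -
  have [measurable]: "\<phi> \<in> borel_measurable borel" by fact
  have "exp_integral \<phi> = ennreal \<bar>det A\<bar> * (\<integral>\<^sup>+x. exp_neg (\<phi> (A *v x)) \<partial>lborel)"
    unfolding exp_integral_def by (rule nn_integral_linear_matrix[OF assms(1), symmetric]) measurable
  then have "ennreal (exp (- c) / \<bar>det A\<bar>) * exp_integral \<phi>
      = ennreal (exp (- c) / \<bar>det A\<bar> * \<bar>det A\<bar>) * (\<integral>\<^sup>+x. exp_neg (\<phi> (A *v x)) \<partial>lborel)"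
    by (subst ennreal_mult) (auto simp: mult.assoc)
  also have "\<dots> = (\<integral>\<^sup>+x. ennreal (exp (- c)) * exp_neg (\<phi> (A *v x)) \<partial>lborel)"
    using assms(1) by (subst nn_integral_cmult) auto
  finally show ?thesis by (simp add: exp_integral_def affine_change_def exp_neg_shift)
qed

lemma legendre_affine_change:
  assumes "A ** B = mat 1" "B ** A = mat 1"
  shows "legendre (affine_change A c \<phi>) = affine_change (transpose B) (- c) (legendre \<phi>)"
proof
  fix y
  have *: "ereal (x \<bullet> y) - affine_change A c \<phi> x = ereal ((A *v x) \<bullet> (transpose B *v y)) - \<phi> (A *v x) + ereal (- c)" for x
  proof -
    have "(transpose B *v y) \<bullet> (A *v x) = y \<bullet> (B *v (A *v x))"
      by (simp only: transpose_matrix_vector dot_lmul_matrix)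
    also have "B *v (A *v x) = x" by (simp only: matrix_vector_mul_assoc assms matrix_vector_mul_lid)
    finally have "(A *v x) \<bullet> (transpose B *v y) = x \<bullet> y" by (simp only: inner_commute)
    moreover have "ereal r - (b + ereal c) = ereal r - b + ereal (- c)" for r b
      by (cases b) auto
    ultimately show ?thesis by (simp only: affine_change_def)
  qed
  have r: "range ((*v) A) = UNIV"
  proof -
    have "y = A *v (B *v y)" for y by (simp only: matrix_vector_mul_assoc assms matrix_vector_mul_lid)
    then show ?thesis by blast
  qed
  have "legendre (affine_change A c \<phi>) y
      = (SUP z\<in>range ((*v) A). ereal (z \<bullet> (transpose B *v y)) - \<phi> z + ereal (- c))"
    unfolding legendre_def by (simp only: * image_image)
  also have "\<dots> = (SUP z. ereal (z \<bullet> (transpose B *v y)) - \<phi> z) + ereal (- c)"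
    unfolding r by (rule SUP_ereal_add_left) auto
  finally show "legendre (affine_change A c \<phi>) y = affine_change (transpose B) (- c) (legendre \<phi>) y"
    by (simp add: affine_change_def legendre_def)
qed

lemma P_legendre_affine_change:
  fixes A :: "real^'n^'n"
  assumes "invertible A" "\<phi> \<in> Cvx"
  shows "P_legendre (affine_change A c \<phi>) = P_legendre \<phi>"
proof -
  obtain B where B: "A ** B = mat 1" "B ** A = mat 1" using assms(1) invertible_def by blast
  have d: "det A * det B = 1" using B(1) by (metis det_I det_mul)
  then have d0: "det A \<noteq> 0" "det (transpose B) \<noteq> 0" by auto
  have "\<bar>det A\<bar> * \<bar>det B\<bar> = 1" using d by (simp flip: abs_mult)
  then have "(exp (- c) / \<bar>det A\<bar>) * (exp c / \<bar>det B\<bar>) = 1"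
    by (simp add: exp_minus field_simps)
  then have one: "ennreal (exp (- c) / \<bar>det A\<bar>) * ennreal (exp c / \<bar>det B\<bar>) = 1"
    by (simp flip: ennreal_mult)
  have "P_legendre (affine_change A c \<phi>)
      = (ennreal (exp (- c) / \<bar>det A\<bar>) * ennreal (exp c / \<bar>det B\<bar>)) * (exp_integral \<phi> * exp_integral (legendre \<phi>))"
    unfolding P_legendre_def legendre_affine_change[OF B]
    using exp_integral_affine_change[OF d0(1) Cvx_measurable[OF assms(2)], of c]
      exp_integral_affine_change[OF d0(2) lsc_measurable[OF legendre_lsc[of \<phi>]], of "- c"]
    by (simp add: det_transpose ac_simps)
  then show ?thesis by (simp add: one P_legendre_def)
qed

lemma affine_change_Cvx_plus:
  assumes "\<phi> \<in> Cvx_plus" "invertible A"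
  shows "affine_change A c \<phi> \<in> Cvx_plus"
proof -
  have \<phi>: "\<phi> \<in> Cvx" and i: "0 < exp_integral \<phi>" "exp_integral \<phi> < \<infinity>"
    using assms(1) by (auto simp: Cvx_plus_def)
  have d: "det A \<noteq> 0" using assms(2) by (simp add: invertible_det_nz)
  have "exp_integral (affine_change A c \<phi>) = ennreal (exp (- c) / \<bar>det A\<bar>) * exp_integral \<phi>"
    by (rule exp_integral_affine_change[OF d Cvx_measurable[OF \<phi>]])
  moreover have "0 < \<dots>" "\<dots> < \<infinity>"
    using i d by (auto simp: ennreal_zero_less_mult_iff ennreal_mult_less_top)
  ultimately show ?thesis using affine_change_Cvx[OF \<phi> assms(2)] by (simp add: Cvx_plus_def)
qed

lemma affine_change_even: "even_fun \<phi> \<Longrightarrow> even_fun (affine_change A c \<phi>)"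
  by (simp add: even_fun_def affine_change_def vec.neg)

section \<open>Coercivity of integrable convex functions\<close>

text \<open>
  The convex hull of a ball and a far point contains many disjoint balls of half the radius, placed
  along the half of the segment that is nearer to the ball; finitely many of them exhaust the
  measure of the set.
\<close>

lemma convex_finite_measure_bounded:
  fixes K :: "'a::euclidean_space set"
  assumes "convex K" "closed K" "r > 0" "ball p r \<subseteq> K" "emeasure lborel K < \<infinity>"
  shows "bounded K"
proof -
  define V where "V = measure lborel (ball (0::'a) (r/2))"
  have V: "V > 0" unfolding V_def using assms by (intro content_ball_pos) auto
  have em: "emeasure lborel (ball c (r/2)) = ennreal V" for c :: 'a
    using assms by (simp add: V_def emeasure_ball content_ball)
  obtain N :: nat where N: "measure lborel K < real N * V"
    using V reals_Archimedean3 by blast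
  have "dist p x \<le> 2 * r * N" if x: "x \<in> K" for x
  proof (rule ccontr)
    define d where "d = dist p x"
    assume "\<not> dist p x \<le> 2 * r * N"
    then have d: "d > 2 * r * N" by (simp add: d_def)
    have N0: "N > 0" using N measure_nonneg[of lborel K] by (cases N) auto
    have d0: "d > 0" using d assms(3) by (smt (verit) mult_nonneg_nonneg of_nat_0_le_iff)
    \<comment> \<open>centres at mutual distance \<open>r\<close>; there is room for \<open>N\<close> of them before the midpoint of \<open>p\<close> and \<open>x\<close>\<close>
    define c where "c = (\<lambda>j::nat. p + (j * r / d) *\<^sub>R (x - p))"
    have sub: "ball (c j) (r/2) \<subseteq> K" if j: "j < N" for j
    proof
      fix z assume z: "z \<in> ball (c j) (r/2)"
      define s where "s = j * r / d"
      have "real j * r \<le> real N * r" using j assms(3) by auto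
      then have "2 * (real j * r) < d" using d by (simp add: mult_ac)
      then have s: "0 \<le> s" "s < 1/2" using d0 assms(3) by (auto simp: s_def field_simps)
      \<comment> \<open>project \<open>z\<close> from \<open>x\<close> back into the ball around \<open>p\<close>; since \<open>s < 1/2\<close>, distances at most double\<close>
      define w where "w = p + (1 / (1 - s)) *\<^sub>R (z - c j)"
      have "dist p w = dist (c j) z / (1 - s)"
        using s by (simp add: w_def dist_norm norm_minus_commute)
      also have "\<dots> < (r/2) / (1/2)"
        using z s assms(3) by (intro frac_less) (auto simp: dist_commute)
      finally have "w \<in> K" using assms(4) by auto
      moreover have "(1 - s) *\<^sub>R w = (1 - s) *\<^sub>R p + (z - c j)"
        using s by (simp add: w_def scaleR_add_right)
      then have "z = (1 - s) *\<^sub>R w + s *\<^sub>R x"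
        by (simp add: c_def s_def algebra_simps)
      ultimately show "z \<in> K"
        using convexD_alt[OF assms(1) \<open>w \<in> K\<close> x, of s] s by simp
    qed
    have disj: "disjoint_family_on (\<lambda>j. ball (c j) (r/2)) {..<N}"
      unfolding disjoint_family_on_def
    proof (intro ballI impI)
      fix i j :: nat assume "i \<noteq> j"
      have "dist (c i) (c j) = norm (((real i - real j) * r / d) *\<^sub>R (x - p))"
        by (simp add: c_def dist_norm algebra_simps diff_divide_distrib)
      also have "\<dots> = \<bar>real i - real j\<bar> * r"
        using d0 assms(3) by (simp add: d_def dist_norm norm_minus_commute abs_mult)
      also have "\<bar>real i - real j\<bar> \<ge> 1" using \<open>i \<noteq> j\<close> by linarith
      then have "\<bar>real i - real j\<bar> * r \<ge> r" using assms(3) by simp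
      finally have "dist (c i) (c j) \<ge> r/2 + r/2" by simp
      then show "ball (c i) (r/2) \<inter> ball (c j) (r/2) = {}"
        by (rule disjoint_ballI)
    qed
    have "ennreal (real N * V) = (\<Sum>j<N. emeasure lborel (ball (c j) (r/2)))"
      using V by (simp add: em ennreal_mult ennreal_of_nat_eq_real_of_nat)
    also have "\<dots> = emeasure lborel (\<Union>j<N. ball (c j) (r/2))"
      by (rule sum_emeasure) (use disj in auto)
    also have "\<dots> \<le> emeasure lborel K"
      by (rule emeasure_mono) (use sub assms(2) in auto)
    also have "\<dots> = ennreal (measure lborel K)"
      using assms(5) by (intro emeasure_eq_ennreal_measure) auto
    finally show False using N V by (simp add: ennreal_le_iff)
  qed
  then show ?thesis unfolding bounded_def by blast
qed

text \<open>
  The domain is the countable union of the sublevel sets with integer bound. If all of these convex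
  sets had empty interior they would be null, and the integral would vanish.
\<close>

lemma Cvx_plus_ball_sublevel:
  fixes \<phi> :: "real^'n \<Rightarrow> ereal"
  assumes "\<phi> \<in> Cvx_plus"
  obtains s p r where "r > 0" "ball p r \<subseteq> {x. \<phi> x \<le> ereal s}"
proof -
  have \<phi>: "lower_semicontinuous \<phi>" "ereal_convex \<phi>" "exp_integral \<phi> > 0"
    using assms by (auto simp: Cvx_plus_def Cvx_def)
  have "\<exists>n::nat. interior {x. \<phi> x \<le> ereal n} \<noteq> {}"
  proof (rule ccontr)
    assume "\<not> ?thesis"
    then have "negligible {x. \<phi> x \<le> ereal (real n)}" for n :: nat
      using negligible_convex_interior[OF ereal_convex_sublevel[OF \<phi>(2)]] by blast
    then have "{x. \<phi> x \<le> ereal (real n)} \<in> null_sets lborel" for n :: nat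
      using lsc_closed_sublevel[OF \<phi>(1)]
      by (auto simp: negligible_iff_null_sets null_sets_completion_iff)
    then have "(\<Union>n::nat. {x. \<phi> x \<le> ereal (real n)}) \<in> null_sets lborel" by blast
    then have "AE x in lborel. x \<notin> (\<Union>n::nat. {x. \<phi> x \<le> ereal (real n)})" by (rule AE_not_in)
    then have "AE x in lborel. exp_neg (\<phi> x) = 0"
    proof eventually_elim
      case (elim x)
      have "\<phi> x = \<infinity>"
      proof (rule ccontr)
        assume "\<phi> x \<noteq> \<infinity>"
        then obtain t where "\<phi> x \<le> ereal t" using ereal_less_infinity_iff[of "\<phi> x"] by auto
        moreover obtain n :: nat where "t \<le> real n" using real_arch_simple by blast
        ultimately have "\<phi> x \<le> ereal (real n)" by (meson ereal_less_eq(3) order_trans)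
        then show False using elim by blast
      qed
      then show ?case by simp
    qed
    then have "exp_integral \<phi> = (\<integral>\<^sup>+(x::real^'n). 0 \<partial>lborel)"
      unfolding exp_integral_def by (rule nn_integral_cong_AE)
    then show False using \<phi>(3) by simp
  qed
  then obtain n :: nat and p where "p \<in> interior {x. \<phi> x \<le> ereal n}" by blast
  then show ?thesis using that unfolding mem_interior by blast
qed

lemma Cvx_plus_sublevel_finite:
  assumes "\<phi> \<in> Cvx_plus"
  shows "emeasure lborel {x. \<phi> x \<le> ereal s} < \<infinity>"
proof -
  have \<phi>: "\<phi> \<in> Cvx" "lower_semicontinuous \<phi>" "exp_integral \<phi> < \<infinity>"
    using assms by (auto simp: Cvx_plus_def Cvx_def)
  let ?K = "{x. \<phi> x \<le> ereal s}"
  have K: "?K \<in> sets lborel" using lsc_closed_sublevel[OF \<phi>(2)] by simp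
  have "ennreal (exp (- s)) * emeasure lborel ?K = (\<integral>\<^sup>+x. ennreal (exp (- s)) * indicator ?K x \<partial>lborel)"
    using K by (simp add: nn_integral_cmult_indicator)
  also have "\<dots> \<le> exp_integral \<phi>"
    unfolding exp_integral_def
    by (intro nn_integral_mono) (use exp_neg_antimono[of _ "ereal s"] in \<open>auto split: split_indicator\<close>)
  finally have "ennreal (exp (- s)) * emeasure lborel ?K < \<infinity>" using \<phi>(3) by simp
  then show ?thesis by (auto simp: ennreal_mult_less_top)
qed

text \<open>
  A convex function that gains \<open>1\<close> before distance \<open>R\<close> continues to grow at rate at least
  \<open>1 / R\<close>: compare \<open>x\<close> with the point at distance \<open>R\<close> on the segment from \<open>p\<close> to \<open>x\<close>.
\<close>

lemma convex_growth:
  fixes \<phi> :: "'a::real_normed_vector \<Rightarrow> ereal"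
  assumes cv: "ereal_convex \<phi>" and p: "\<phi> p \<le> ereal m" and R: "R > 0"
    and K: "\<And>x. \<phi> x \<le> ereal (m + 1) \<Longrightarrow> dist p x < R" and x: "R \<le> dist p x"
  shows "ereal (m + dist p x / R) \<le> \<phi> x"
proof (rule ccontr)
  assume "\<not> ?thesis"
  then obtain t where t: "\<phi> x \<le> ereal t" "t < m + dist p x / R"
    by (metis ereal_dense2 ereal_less(2) less_ereal.simps(1) less_imp_le not_le)
  define \<theta> where "\<theta> = R / dist p x"
  have d: "dist p x > 0" using x R by linarith
  have \<theta>: "0 < \<theta>" "\<theta> \<le> 1" using d x R by (auto simp: \<theta>_def)
  have "\<phi> ((1 - \<theta>) *\<^sub>R p + \<theta> *\<^sub>R x) \<le> ereal ((1 - \<theta>) * m + \<theta> * t)"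
    using ereal_convexD[OF cv p t(1), of "1 - \<theta>" \<theta>] \<theta> by simp
  also have "\<theta> * t \<le> \<theta> * (m + dist p x / R)" using t \<theta> by (intro mult_left_mono) auto
  then have "(1 - \<theta>) * m + \<theta> * t \<le> m + 1" using d R by (simp add: \<theta>_def algebra_simps)
  finally have "dist p ((1 - \<theta>) *\<^sub>R p + \<theta> *\<^sub>R x) < R" using K by simp
  moreover have "dist p ((1 - \<theta>) *\<^sub>R p + \<theta> *\<^sub>R x) = \<theta> * dist p x"
  proof -
    have "p - ((1 - \<theta>) *\<^sub>R p + \<theta> *\<^sub>R x) = \<theta> *\<^sub>R (p - x)" by (simp add: algebra_simps)
    then show ?thesis using \<theta> by (simp add: dist_norm)
  qed
  ultimately show False using d by (simp add: \<theta>_def)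
qed

text \<open>
  A very small value at \<open>x\<close> would, by convexity along the line through \<open>x\<close> and \<open>p\<close>, force a
  small value at \<open>p\<close>, because the function is bounded above a little beyond \<open>p\<close>.
\<close>

lemma convex_bounded_below:
  fixes \<phi> :: "'a::real_normed_vector \<Rightarrow> ereal"
  assumes cv: "ereal_convex \<phi>" and r: "r > 0" and s: "ball p r \<subseteq> {x. \<phi> x \<le> ereal s}"
    and m: "ereal m \<le> \<phi> p" and R: "R > 0"
  obtains C where "\<And>x. dist p x \<le> R \<Longrightarrow> ereal (- C) \<le> \<phi> x"
proof -
  define \<tau> where "\<tau> = r / (2 * R)"
  have \<tau>: "\<tau> > 0" using r R by (simp add: \<tau>_def)
  \<comment> \<open>the value at which the convexity inequality at \<open>p\<close> below fails\<close>
  define C where "C = (s - m * (1 + \<tau>)) / \<tau> + 1"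
  have "ereal (- C) \<le> \<phi> x" if x: "dist p x \<le> R" for x
  proof (rule ccontr)
    assume "\<not> ?thesis"
    then have x': "\<phi> x \<le> ereal (- C)" by simp
    define w where "w = p - \<tau> *\<^sub>R (x - p)"
    have "dist p w = \<tau> * dist p x" using \<tau> by (simp add: w_def dist_norm norm_minus_commute)
    also have "\<dots> \<le> \<tau> * R" using x \<tau> by simp
    also have "\<dots> < r" using r R by (simp add: \<tau>_def)
    finally have w: "\<phi> w \<le> ereal s" using s by auto
    have "(1 / (1 + \<tau>)) *\<^sub>R w + (\<tau> / (1 + \<tau>)) *\<^sub>R x = (1 / (1 + \<tau>)) *\<^sub>R (w + \<tau> *\<^sub>R x)"
      by (simp add: algebra_simps)
    also have "w + \<tau> *\<^sub>R x = (1 + \<tau>) *\<^sub>R p" by (simp add: w_def algebra_simps)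
    also have "(1 / (1 + \<tau>)) *\<^sub>R (1 + \<tau>) *\<^sub>R p = p" using \<tau> by simp
    finally have p: "(1 / (1 + \<tau>)) *\<^sub>R w + (\<tau> / (1 + \<tau>)) *\<^sub>R x = p" .
    have "\<phi> p \<le> ereal (1 / (1 + \<tau>) * s + \<tau> / (1 + \<tau>) * (- C))"
      using ereal_convexD[OF cv w x', of "1 / (1 + \<tau>)" "\<tau> / (1 + \<tau>)"] \<tau>
      unfolding p by (simp add: add_divide_distrib[symmetric])
    with m have "m \<le> 1 / (1 + \<tau>) * s + \<tau> / (1 + \<tau>) * (- C)"
      by (metis ereal_less_eq(3) order_trans)
    also have "\<dots> = (s - \<tau> * C) / (1 + \<tau>)" by (simp add: diff_divide_distrib)
    finally have "m * (1 + \<tau>) \<le> s - \<tau> * C" using \<tau> by (simp add: pos_le_divide_eq)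
    moreover have "\<tau> * C = s - m * (1 + \<tau>) + \<tau>" using \<tau> by (simp add: C_def field_simps)
    ultimately show False using \<tau> by simp
  qed
  then show ?thesis using that by blast
qed

text \<open>
  A sublevel set with interior has finite measure, hence is bounded, and then the function grows
  linearly outside a ball; inside this ball it is bounded below.
\<close>

lemma Cvx_plus_coercive:
  assumes "\<phi> \<in> Cvx_plus"
  shows "\<exists>a>0. \<exists>C. \<forall>x. ereal (a * norm x - C) \<le> \<phi> x"
proof -
  have \<phi>: "lower_semicontinuous \<phi>" "ereal_convex \<phi>" "\<And>x. \<phi> x \<noteq> -\<infinity>"
    using assms by (auto simp: Cvx_plus_def Cvx_def proper_fun_def)
  obtain s p r where r: "r > 0" and s: "ball p r \<subseteq> {x. \<phi> x \<le> ereal s}"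
    using Cvx_plus_ball_sublevel[OF assms] .
  then have p: "\<phi> p \<le> ereal s" using centre_in_ball by blast
  have "bounded {x. \<phi> x \<le> ereal (s + 1)}"
  proof (rule convex_finite_measure_bounded)
    show "ball p r \<subseteq> {x. \<phi> x \<le> ereal (s + 1)}"
      using s by (auto intro: order_trans)
  qed (use \<phi> r Cvx_plus_sublevel_finite[OF assms] ereal_convex_sublevel lsc_closed_sublevel in auto)
  then obtain R0 where "\<And>x. \<phi> x \<le> ereal (s + 1) \<Longrightarrow> dist p x \<le> R0"
    unfolding bounded_any_center[of _ p] by auto
  define R where "R = \<bar>R0\<bar> + 1"
  have R: "R > 0" and K: "\<And>x. \<phi> x \<le> ereal (s + 1) \<Longrightarrow> dist p x < R"
    using \<open>\<And>x. \<phi> x \<le> ereal (s + 1) \<Longrightarrow> dist p x \<le> R0\<close> by (force simp: R_def)+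
  obtain m where "\<phi> p = ereal m" using p \<phi>(3)[of p] by (cases "\<phi> p") auto
  then obtain C where C: "\<And>x. dist p x \<le> R \<Longrightarrow> ereal (- C) \<le> \<phi> x"
    using convex_bounded_below[OF \<phi>(2) r s, of m R] R by auto
  define D where "D = norm p / R + \<bar>s\<bar> + \<bar>C\<bar> + 1"
  have "ereal (1 / R * norm x - D) \<le> \<phi> x" for x
  proof -
    have "norm x \<le> norm p + dist p x"
      using norm_triangle_ineq4[of p "p - x"] by (simp add: dist_norm)
    then have n: "norm x / R \<le> norm p / R + dist p x / R"
      using R by (simp add: field_simps)
    show ?thesis
    proof (cases "R \<le> dist p x")
      case True
      have "1 / R * norm x - D \<le> s + dist p x / R" using n by (simp add: D_def)
      then show ?thesis
        using convex_growth[OF \<phi>(2) p R K True] by (meson ereal_less_eq(3) order_trans)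
    next
      case False
      then have "dist p x / R \<le> 1" using R by simp
      then have "1 / R * norm x - D \<le> - C" using n by (simp add: D_def)
      then show ?thesis using C[of x] False by (meson ereal_less_eq(3) order_trans linear)
    qed
  qed
  then show ?thesis using R by (intro exI[of _ "1 / R"] conjI exI[of _ D]) auto
qed

section \<open>Integrability and the centroid\<close>

lemma power_le_fact_exp: "x \<ge> 0 \<Longrightarrow> x ^ n \<le> fact n * exp (x::real)"
proof -
  assume x: "x \<ge> 0"
  have "(\<Sum>k\<in>{n}. x ^ k /\<^sub>R fact k) \<le> (\<Sum>k. x ^ k /\<^sub>R fact k)"
    by (rule sum_le_suminf) (use x summable_exp_generic[of x] in auto)
  then show ?thesis by (simp add: exp_def field_simps)
qed

text \<open>
  Decompose the space into unit shells. The volume of the ball of radius \<open>k + 1\<close> is a power of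
  \<open>k + 1\<close>, and the exponential series bounds it by a multiple of \<open>exp (a k / 2)\<close>, which
  leaves a geometric series.
\<close>

lemma integrable_exp_norm:
  assumes "a > 0"
  shows "integrable lborel (\<lambda>x::'a::euclidean_space. exp (- a * norm x))"
proof -
  define n where "n = DIM('a)"
  define V where "V = unit_ball_vol (real n)"
  define u where "u = (\<lambda>k::nat. exp (- a * k) * (V * (k + 1) ^ n))"
  have V: "V \<ge> 0" by (simp add: V_def unit_ball_vol_nonneg)
  have u0: "u k \<ge> 0" for k using V by (simp add: u_def)
  have "summable u"
  proof (rule summable_comparison_test')
    let ?D = "V * fact n * (2 / a) ^ n * exp (a / 2)"
    show "summable (\<lambda>k. ?D * exp (- (a / 2)) ^ k)"
      using assms by (intro summable_mult summable_geometric) auto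
    show "norm (u k) \<le> ?D * exp (- (a / 2)) ^ k" if "k \<ge> 0" for k
    proof -
      have "(a / 2 * (real k + 1)) ^ n \<le> fact n * exp (a / 2 * (real k + 1))"
        by (rule power_le_fact_exp) (use assms in auto)
      then have "(real k + 1) ^ n \<le> (2 / a) ^ n * (fact n * exp (a / 2 * (real k + 1)))"
        using assms by (simp add: power_mult_distrib power_divide pos_le_divide_eq pos_divide_le_eq mult_ac)
      then have "u k \<le> exp (- a * k) * (V * ((2 / a) ^ n * (fact n * exp (a / 2 * (real k + 1)))))"
        unfolding u_def using V by (intro mult_left_mono) (auto simp: add_ac)
      also have "\<dots> = V * fact n * (2 / a) ^ n * (exp (- a * k) * exp (a / 2 * (real k + 1)))"
        by simp
      also have "exp (- a * k) * exp (a / 2 * (real k + 1)) = exp (a / 2) * exp (- (a / 2)) ^ k"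
        by (simp flip: exp_add exp_of_nat_mult) (simp add: field_simps)
      finally show ?thesis using u0[of k] by (simp add: mult.assoc)
    qed
  qed
  have "(\<integral>\<^sup>+(x::'a). ennreal (exp (- a * norm x)) \<partial>lborel)
      \<le> (\<integral>\<^sup>+(x::'a). (\<Sum>k. ennreal (exp (- a * real k)) * indicator (ball 0 (real k + 1)) x) \<partial>lborel)"
  proof (rule nn_integral_mono)
    fix x :: 'a
    define k where "k = nat \<lfloor>norm x\<rfloor>"
    have k: "real k \<le> norm x" "norm x < real k + 1" by (auto simp: k_def)
    have "ennreal (exp (- a * norm x)) \<le> ennreal (exp (- a * real k)) * indicator (ball 0 (real k + 1)) x"
      using k assms by (auto intro!: ennreal_leI)
    also have "\<dots> = (\<Sum>j\<in>{k}. ennreal (exp (- a * real j)) * indicator (ball 0 (real j + 1)) x)"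
      by (subst sum.insert) (auto simp del: sum_mult_indicator)
    also have "\<dots> \<le> (\<Sum>k. ennreal (exp (- a * real k)) * indicator (ball 0 (real k + 1)) x)"
      by (rule sum_le_suminf) auto
    finally show "ennreal (exp (- a * norm x)) \<le> (\<Sum>k. ennreal (exp (- a * real k)) * indicator (ball 0 (real k + 1)) x)" .
  qed
  also have "\<dots> = (\<Sum>k. \<integral>\<^sup>+(x::'a). ennreal (exp (- a * real k)) * indicator (ball 0 (real k + 1)) x \<partial>lborel)"
    by (rule nn_integral_suminf) (intro borel_measurable_times_ennreal borel_measurable_indicator; simp)
  also have "\<dots> = (\<Sum>k. ennreal (u k))"
    using V by (simp add: nn_integral_cmult_indicator emeasure_ball u_def ennreal_mult V_def n_def add_ac)
  also have "\<dots> = ennreal (suminf u)"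
    using u0 \<open>summable u\<close> by (intro suminf_ennreal2)
  also have "\<dots> < \<infinity>" by simp
  finally show ?thesis
    by (intro integrableI_bounded) (auto intro!: borel_measurable_continuous_onI continuous_intros)
qed

lemma norm_mult_exp_le:
  assumes "a > 0"
  shows "norm x * exp (- a * norm x) \<le> 2 / a * exp (- (a / 2) * norm x)"
proof -
  have "a / 2 * norm x \<le> exp (a / 2 * norm x)"
    using exp_ge_add_one_self[of "a / 2 * norm x"] by linarith
  then have "a / 2 * norm x * exp (- a * norm x) \<le> exp (a / 2 * norm x) * exp (- a * norm x)"
    by (rule mult_right_mono) simp
  also have "\<dots> = exp (- (a / 2) * norm x)" by (simp flip: exp_add)
  finally show ?thesis using assms by (simp add: field_simps)
qed

text \<open>
  The real-valued version of the weight, for use in Bochner integrals.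
\<close>

definition density_fun :: "(real^'n \<Rightarrow> ereal) \<Rightarrow> real^'n \<Rightarrow> real" where
  "density_fun \<phi> x = enn2real (exp_neg (\<phi> x))"

lemma density_fun_nonneg [simp]: "0 \<le> density_fun \<phi> x"
  by (simp add: density_fun_def)

lemma density_fun_ereal: "\<phi> x = ereal t \<Longrightarrow> density_fun \<phi> x = exp (- t)"
  by (simp add: density_fun_def)

lemma density_fun_infinity: "\<phi> x = \<infinity> \<Longrightarrow> density_fun \<phi> x = 0"
  by (simp add: density_fun_def)

lemma density_fun_le: "ereal t \<le> \<phi> x \<Longrightarrow> density_fun \<phi> x \<le> exp (- t)"
  unfolding density_fun_def by (rule enn2real_leI) (auto intro: exp_neg_le_real)

lemma density_fun_measurable [measurable]:
  "\<phi> \<in> borel_measurable borel \<Longrightarrow> density_fun \<phi> \<in> borel_measurable borel"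
  unfolding density_fun_def by measurable

lemma ennreal_density_fun: "\<phi> x \<noteq> -\<infinity> \<Longrightarrow> ennreal (density_fun \<phi> x) = exp_neg (\<phi> x)"
  unfolding density_fun_def using exp_neg_less_top[of "\<phi> x"] by (intro ennreal_enn2real) auto

lemma exp_integral_eq_density:
  "(\<And>x. \<phi> x \<noteq> -\<infinity>) \<Longrightarrow> exp_integral \<phi> = (\<integral>\<^sup>+x. ennreal (density_fun \<phi> x) \<partial>lborel)"
  unfolding exp_integral_def by (intro nn_integral_cong) (simp add: ennreal_density_fun)

lemma Cvx_plusD:
  assumes "\<phi> \<in> Cvx_plus"
  shows "\<phi> \<in> Cvx" "lower_semicontinuous \<phi>" "ereal_convex \<phi>" "\<And>x. \<phi> x \<noteq> -\<infinity>"
    "exp_integral \<phi> > 0" "exp_integral \<phi> < \<infinity>" "\<phi> \<in> borel_measurable borel"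
  using assms by (auto simp: Cvx_plus_def Cvx_def proper_fun_def lsc_measurable)

lemma integrable_density_fun:
  assumes "\<phi> \<in> Cvx_plus"
  shows "integrable lborel (density_fun \<phi>)"
    and "(\<integral>x. density_fun \<phi> x \<partial>lborel) = enn2real (exp_integral \<phi>)"
    and "(\<integral>x. density_fun \<phi> x \<partial>lborel) > 0"
proof -
  note \<phi> = Cvx_plusD[OF assms]
  have [measurable]: "\<phi> \<in> borel_measurable borel" by fact
  have m: "density_fun \<phi> \<in> borel_measurable lborel" by measurable
  have e: "exp_integral \<phi> = (\<integral>\<^sup>+x. ennreal (density_fun \<phi> x) \<partial>lborel)"
    by (rule exp_integral_eq_density) (rule \<phi>)
  show i: "integrable lborel (density_fun \<phi>)"
    by (rule integrableI_nonneg) (use m e \<phi> in auto)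
  show eq: "(\<integral>x. density_fun \<phi> x \<partial>lborel) = enn2real (exp_integral \<phi>)"
    unfolding e by (rule integral_eq_nn_integral) (use m in auto)
  show "(\<integral>x. density_fun \<phi> x \<partial>lborel) > 0"
    unfolding eq using \<phi> by (simp add: enn2real_positive_iff)
qed

lemma integrable_first_moment:
  assumes "\<phi> \<in> Cvx_plus"
  shows "integrable lborel (\<lambda>x. density_fun \<phi> x *\<^sub>R x)"
proof -
  obtain a C where a: "a > 0" and C: "\<And>x. ereal (a * norm x - C) \<le> \<phi> x"
    using Cvx_plus_coercive[OF assms] by blast
  have [measurable]: "\<phi> \<in> borel_measurable borel" by (rule Cvx_plusD[OF assms])
  have "integrable lborel (\<lambda>x::real^'a. exp C * (2 / a) * exp (- (a / 2) * norm x))"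
    by (intro integrable_mult_right integrable_exp_norm) (use a in auto)
  then show ?thesis
  proof (rule Bochner_Integration.integrable_bound)
    show "AE x in lborel. norm (density_fun \<phi> x *\<^sub>R x) \<le> norm (exp C * (2 / a) * exp (- (a / 2) * norm x))"
    proof (rule AE_I2)
      fix x
      have "norm (density_fun \<phi> x *\<^sub>R x) \<le> exp (- (a * norm x - C)) * norm x"
        using density_fun_le[where \<phi> = \<phi> and x = x, OF C] by (simp add: mult_right_mono)
      also have "\<dots> = exp C * (norm x * exp (- a * norm x))" by (simp add: exp_diff exp_minus field_simps)
      also have "\<dots> \<le> exp C * (2 / a * exp (- (a / 2) * norm x))"
        using norm_mult_exp_le[OF a, of x] by (intro mult_left_mono) auto
      finally show "norm (density_fun \<phi> x *\<^sub>R x) \<le> norm (exp C * (2 / a) * exp (- (a / 2) * norm x))"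
        using a by (simp add: mult.assoc)
    qed
  qed measurable
qed

lemma centroid_eq_0_iff:
  assumes "\<phi> \<in> Cvx_plus"
  shows "centroid \<phi> = 0 \<longleftrightarrow> (\<integral>x. density_fun \<phi> x *\<^sub>R x \<partial>lborel) = 0"
  using integrable_density_fun(2,3)[OF assms] by (simp add: centroid_def density_fun_def)

lemma even_centroid:
  fixes \<phi> :: "real^'n \<Rightarrow> ereal"
  assumes "\<phi> \<in> Cvx_plus" "even_fun \<phi>"
  shows "centroid \<phi> = 0"
proof -
  have [measurable]: "\<phi> \<in> borel_measurable borel" by (rule Cvx_plusD[OF assms(1)])
  have ev: "density_fun \<phi> (- x) = density_fun \<phi> x" for x
    using assms(2) by (simp add: even_fun_def density_fun_def)
  have "lborel = distr lborel borel (\<lambda>x::real^'n. - x)"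
    by (subst lborel_affine[of "-1" 0]) (auto simp: density_1 one_ennreal_def[symmetric])
  then have "(\<integral>x. density_fun \<phi> x *\<^sub>R x \<partial>lborel) = (\<integral>x. density_fun \<phi> x *\<^sub>R x \<partial>distr lborel borel (\<lambda>x. - x))"
    by (rule arg_cong[where f = "\<lambda>M. \<integral>x. density_fun \<phi> x *\<^sub>R x \<partial>M"])
  also have "\<dots> = (\<integral>x. density_fun \<phi> (- x) *\<^sub>R (- x) \<partial>lborel)"
    by (rule integral_distr) measurable
  also have "\<dots> = - (\<integral>x. density_fun \<phi> x *\<^sub>R x \<partial>lborel)"
    by (simp add: ev)
  finally have "(\<integral>x. density_fun \<phi> x *\<^sub>R x \<partial>lborel) = - (\<integral>x. density_fun \<phi> x *\<^sub>R x \<partial>lborel)" .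
  moreover have "v = 0" if "v = - v" for v :: "real^'n"
    using that eq_neg_iff_add_eq_0[of v v] by (simp flip: scaleR_2)
  ultimately have "(\<integral>x. density_fun \<phi> x *\<^sub>R x \<partial>lborel) = 0" by blast
  then show ?thesis by (simp only: centroid_eq_0_iff[OF assms(1)])
qed

section \<open>The value of a centred function at the origin\<close>

lemma integral_lborel_dilation:
  fixes f :: "'a::euclidean_space \<Rightarrow> real"
  assumes "f \<in> borel_measurable borel" "c > 0" "integrable lborel f"
  shows "integrable lborel (\<lambda>x. f (t + c *\<^sub>R x))"
    and "(\<integral>x. f (t + c *\<^sub>R x) \<partial>lborel) = (\<integral>x. f x \<partial>lborel) / c ^ DIM('a)"
proof -
  define T where "T = (\<lambda>x::'a. t + c *\<^sub>R x)"
  have [measurable]: "T \<in> borel \<rightarrow>\<^sub>M borel" unfolding T_def by measurable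
  have [measurable]: "f \<in> borel_measurable borel" by fact
  have eq: "lborel = density (distr lborel borel T) (\<lambda>_. ennreal (c ^ DIM('a)))"
    using lborel_affine[of c t] assms(2) by (simp add: T_def)
  have "integrable (density (distr lborel borel T) (\<lambda>_. ennreal (c ^ DIM('a)))) f"
    using assms(3) unfolding eq[symmetric] .
  then have "integrable (distr lborel borel T) (\<lambda>x. c ^ DIM('a) *\<^sub>R f x)"
    by (simp add: integrable_density less_imp_le[OF assms(2)])
  then have "integrable lborel (\<lambda>x. c ^ DIM('a) *\<^sub>R f (T x))"
    by (subst (asm) integrable_distr_eq) auto
  then show "integrable lborel (\<lambda>x. f (t + c *\<^sub>R x))"
    using assms(2) by (simp add: T_def)
  have "(\<integral>x. f x \<partial>lborel) = (\<integral>x. f x \<partial>density (distr lborel borel T) (\<lambda>_. ennreal (c ^ DIM('a))))"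
    unfolding eq[symmetric] ..
  also have "\<dots> = (\<integral>x. c ^ DIM('a) *\<^sub>R f x \<partial>distr lborel borel T)"
    by (rule integral_density) (use assms(2) in auto)
  also have "\<dots> = (\<integral>x. c ^ DIM('a) *\<^sub>R f (T x) \<partial>lborel)"
    by (rule integral_distr) auto
  finally show "(\<integral>x. f (t + c *\<^sub>R x) \<partial>lborel) = (\<integral>x. f x \<partial>lborel) / c ^ DIM('a)"
    using assms(2) by (simp add: T_def)
qed

text \<open>
  The mean of \<open>\<phi>\<close> with respect to the density \<open>exp (- \<phi>)\<close> exceeds the value at an arbitrary
  point \<open>x0\<close> by at most a dimensional constant. Shrinking space towards \<open>x0\<close> by the factor \<open>2\<close>
  multiplies the integral of the density by \<open>2 ^ n\<close>. By convexity, the dilated density is at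
  least \<open>exp (- \<phi>) * exp ((\<phi> - m) / 2)\<close>, and \<open>exp u \<ge> 1 + u\<close> makes the excess
  \<open>\<phi> - m\<close> appear.
\<close>

lemma entropy_bound:
  fixes \<phi> :: "real^'n \<Rightarrow> ereal"
  assumes "\<phi> \<in> Cvx_plus" and x0: "\<phi> x0 \<le> ereal m"
  defines "h \<equiv> (\<lambda>x. density_fun \<phi> x * (real_of_ereal (\<phi> x) - m))"
  shows "integrable lborel h"
    and "(\<integral>x. h x \<partial>lborel) \<le> 2 * (2 ^ CARD('n) - 1) * (\<integral>x. density_fun \<phi> x \<partial>lborel)"
proof -
  note \<phi> = Cvx_plusD[OF assms(1)]
  note i = integrable_density_fun(1)[OF assms(1)]
  have [measurable]: "\<phi> \<in> borel_measurable borel" by fact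
  obtain a C where "a > 0" and C: "\<And>x. ereal (a * norm x - C) \<le> \<phi> x"
    using Cvx_plus_coercive[OF assms(1)] by blast
  have C': "ereal (- C) \<le> \<phi> x" for x
  proof -
    have "- C \<le> a * norm x - C" using \<open>a > 0\<close> by simp
    then show ?thesis using C[of x] by (meson ereal_less_eq(3) order_trans)
  qed
  \<comment> \<open>the density dilated by \<open>2\<close> about \<open>x0\<close>\<close>
  define g where "g = (\<lambda>x. density_fun \<phi> ((1/2) *\<^sub>R x0 + (1/2) *\<^sub>R x))"
  have gi: "integrable lborel g"
    unfolding g_def by (rule integral_lborel_dilation(1)) (use i in auto)
  have gI: "(\<integral>x. g x \<partial>lborel) = 2 ^ CARD('n) * (\<integral>x. density_fun \<phi> x \<partial>lborel)"
    unfolding g_def by (subst integral_lborel_dilation(2)) (use i in \<open>auto simp: power_divide\<close>)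
  have upper: "h x \<le> 2 * (g x - density_fun \<phi> x)" for x
  proof (cases "\<phi> x")
    case (real t)
    have "\<phi> ((1/2) *\<^sub>R x0 + (1/2) *\<^sub>R x) \<le> ereal ((1/2) * m + (1/2) * t)"
      using ereal_convexD[OF \<phi>(3) x0, of x t "1/2" "1/2"] real by simp
    then obtain v where v: "\<phi> ((1/2) *\<^sub>R x0 + (1/2) *\<^sub>R x) = ereal v" "v \<le> (m + t) / 2"
      using \<phi>(4)[of "(1/2) *\<^sub>R x0 + (1/2) *\<^sub>R x"]
      by (cases "\<phi> ((1/2) *\<^sub>R x0 + (1/2) *\<^sub>R x)") auto
    \<comment> \<open>the inequality \<open>1 + u \<le> exp u\<close> with \<open>u = (t - m) / 2\<close>\<close>
    have "exp (- t) * (1 + (t - m) / 2) \<le> exp (- t) * exp ((t - m) / 2)"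
      by (intro mult_left_mono) auto
    also have "\<dots> = exp (- ((m + t) / 2))" by (simp flip: exp_add) (simp add: field_simps)
    also have "\<dots> \<le> exp (- v)" using v by simp
    also have "\<dots> = g x" using v by (simp add: g_def density_fun_ereal)
    finally have "exp (- t) * (t - m) \<le> 2 * (g x - exp (- t))" by (simp add: field_simps)
    then show ?thesis using real by (simp add: h_def density_fun_ereal)
  next
    case PInf
    then show ?thesis by (simp add: h_def density_fun_infinity g_def)
  next
    case MInf
    then show ?thesis using \<phi>(4) by simp
  qed
  have lower: "- (\<bar>C\<bar> + \<bar>m\<bar>) * density_fun \<phi> x \<le> h x" for x
  proof (cases "\<phi> x")
    case (real t)
    then have "- (\<bar>C\<bar> + \<bar>m\<bar>) \<le> t - m" using C'[of x] by simp
    then have "density_fun \<phi> x * - (\<bar>C\<bar> + \<bar>m\<bar>) \<le> density_fun \<phi> x * (t - m)"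
      by (intro mult_left_mono) auto
    then show ?thesis using real by (simp add: h_def mult.commute)
  next
    case PInf
    then show ?thesis by (simp add: h_def density_fun_infinity)
  next
    case MInf
    then show ?thesis using \<phi>(4) by simp
  qed
  show hi: "integrable lborel h"
  proof (rule Bochner_Integration.integrable_bound)
    show "integrable lborel (\<lambda>x. 2 * g x + (\<bar>C\<bar> + \<bar>m\<bar>) * density_fun \<phi> x)"
      using i gi by (intro Bochner_Integration.integrable_add integrable_mult_right)
    show "h \<in> borel_measurable lborel" unfolding h_def by measurable
    have "norm (h x) \<le> norm (2 * g x + (\<bar>C\<bar> + \<bar>m\<bar>) * density_fun \<phi> x)" for x
    proof -
      have "0 \<le> density_fun \<phi> x" "0 \<le> g x" "0 \<le> (\<bar>C\<bar> + \<bar>m\<bar>) * density_fun \<phi> x" by (auto simp: g_def)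
      with upper[of x] lower[of x] show ?thesis
        unfolding real_norm_def minus_mult_left[symmetric] right_diff_distrib by linarith
    qed
    then show "AE x in lborel. norm (h x) \<le> norm (2 * g x + (\<bar>C\<bar> + \<bar>m\<bar>) * density_fun \<phi> x)" by simp
  qed
  have "(\<integral>x. h x \<partial>lborel) \<le> (\<integral>x. 2 * (g x - density_fun \<phi> x) \<partial>lborel)"
    by (rule integral_mono) (use hi i gi upper in auto)
  also have "\<dots> = 2 * (2 ^ CARD('n) - 1) * (\<integral>x. density_fun \<phi> x \<partial>lborel)"
    using i gi by (simp add: gI algebra_simps)
  finally show "(\<integral>x. h x \<partial>lborel) \<le> 2 * (2 ^ CARD('n) - 1) * (\<integral>x. density_fun \<phi> x \<partial>lborel)" .
qed

lemma epigraph_closed_convex: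
  fixes \<phi> :: "'a::real_normed_vector \<Rightarrow> ereal"
  assumes "lower_semicontinuous \<phi>" "ereal_convex \<phi>"
  shows "closed {(x, t). \<phi> x \<le> ereal t}" "convex {(x, t). \<phi> x \<le> ereal t}"
proof -
  have "- {(x, t). \<phi> x \<le> ereal t} = (\<Union>r::real. {x. ereal r < \<phi> x} \<times> {..<r})"
  proof (rule set_eqI, clarify)
    fix x t
    have "\<not> \<phi> x \<le> ereal t \<longleftrightarrow> (\<exists>r. ereal r < \<phi> x \<and> t < r)"
      by (metis ereal_dense2 less_ereal.simps(1) less_trans not_le)
    then show "(x, t) \<in> - {(x, t). \<phi> x \<le> ereal t} \<longleftrightarrow> (x, t) \<in> (\<Union>r::real. {x. ereal r < \<phi> x} \<times> {..<r})"
      by auto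
  qed
  moreover have "open \<dots>"
    using assms(1) by (auto simp: lsc_iff_open intro!: open_Times)
  ultimately show "closed {(x, t). \<phi> x \<le> ereal t}" by (simp add: closed_def)
  show "convex {(x, t). \<phi> x \<le> ereal t}"
    unfolding convex_def by (auto intro: ereal_convexD[OF assms(2)])
qed

text \<open>
  Jensen's inequality for a density with centroid \<open>0\<close>, proved by separation: if the point
  \<open>(0, t)\<close>, with \<open>t\<close> the mean of \<open>\<phi>\<close>, were not in the closed convex epigraph, a hyperplane
  would separate it strictly, although \<open>(0, t)\<close> is the barycentre of a probability measure on
  the epigraph. Together with \<open>entropy_bound\<close> the value at the origin is then within a
  dimensional constant of the infimum of \<open>\<phi>\<close>.
\<close>

lemma centroid_value_le:
  fixes \<phi> :: "real^'n \<Rightarrow> ereal"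
  assumes "\<phi> \<in> Cvx_plus" "centroid \<phi> = 0" "\<phi> x0 \<le> ereal m"
  shows "\<phi> 0 \<le> ereal (m + 2 * (2 ^ CARD('n) - 1))"
proof -
  note \<phi> = Cvx_plusD[OF assms(1)]
  define f where "f = density_fun \<phi>"
  define I where "I = (\<integral>x. f x \<partial>lborel)"
  have I: "I > 0" and fi: "integrable lborel f"
    using integrable_density_fun[OF assms(1)] by (auto simp: I_def f_def)
  have xi: "integrable lborel (\<lambda>x. f x *\<^sub>R x)" and x0: "(\<integral>x. f x *\<^sub>R x \<partial>lborel) = 0"
    using integrable_first_moment[OF assms(1)] assms(2) centroid_eq_0_iff[OF assms(1)] by (auto simp: f_def)
  define h where "h = (\<lambda>x. f x * (real_of_ereal (\<phi> x) - m))"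
  have hi: "integrable lborel h" and hb: "(\<integral>x. h x \<partial>lborel) \<le> 2 * (2 ^ CARD('n) - 1) * I"
    using entropy_bound[OF assms(1,3)] by (auto simp: h_def f_def I_def)
  define t where "t = m + (\<integral>x. h x \<partial>lborel) / I"
  have "(\<integral>x. h x \<partial>lborel) / I \<le> 2 * (2 ^ CARD('n) - 1)"
    using hb I by (simp add: pos_divide_le_eq)
  then have t: "t \<le> m + 2 * (2 ^ CARD('n) - 1)" by (simp add: t_def)
  have "\<phi> 0 \<le> ereal t"
  proof (rule ccontr)
    assume "\<not> \<phi> 0 \<le> ereal t"
    then have "(0, t) \<notin> {(x, t). \<phi> x \<le> ereal t}" by simp
    from separating_hyperplane_closed_point[OF epigraph_closed_convex(2,1)[OF \<phi>(2,3)] this]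
    obtain a s b where sep: "inner (a, s) (0::real^'n, t) < b"
      "\<And>x r. \<phi> x \<le> ereal r \<Longrightarrow> b < inner (a, s) (x, r)"
      by (auto simp: split_paired_Ex)
    \<comment> \<open>the separation inequality at \<open>(x, \<phi> x)\<close>, weighted by the density; both sides vanish where \<open>\<phi>\<close> is infinite\<close>
    have "b * f x \<le> a \<bullet> (f x *\<^sub>R x) + s * (h x + m * f x)" for x
    proof (cases "\<phi> x")
      case (real r)
      have "b \<le> a \<bullet> x + s * r" using sep(2)[of x r] real by simp
      then have "f x * b \<le> f x * (a \<bullet> x + s * r)" by (intro mult_left_mono) (auto simp: f_def)
      then show ?thesis using real by (simp add: h_def algebra_simps)
    next
      case PInf
      then show ?thesis by (simp add: h_def f_def density_fun_infinity)
    next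
      case MInf
      then show ?thesis using \<phi>(4) by simp
    qed
    then have "(\<integral>x. b * f x \<partial>lborel) \<le> (\<integral>x. a \<bullet> (f x *\<^sub>R x) + s * (h x + m * f x) \<partial>lborel)"
      by (intro integral_mono Bochner_Integration.integrable_add integrable_mult_right integrable_inner_right)
         (use fi hi xi in auto)
    also have "\<dots> = (\<integral>x. a \<bullet> (f x *\<^sub>R x) \<partial>lborel) + (\<integral>x. s * (h x + m * f x) \<partial>lborel)"
      by (intro Bochner_Integration.integral_add Bochner_Integration.integrable_add integrable_mult_right
            integrable_inner_right) (use fi hi xi in auto)
    also have "(\<integral>x. a \<bullet> (f x *\<^sub>R x) \<partial>lborel) = 0"
      using integral_inner_right[of a, OF xi] x0 by simp
    also have "(\<integral>x. s * (h x + m * f x) \<partial>lborel) = s * t * I"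
      using fi hi I by (simp add: t_def I_def[symmetric] field_simps)
    also have "(\<integral>x. b * f x \<partial>lborel) = b * I" by (simp add: I_def)
    finally have "b \<le> s * t" using I by simp
    then show False using sep(1) by simp
  qed
  then show ?thesis using t by (meson ereal_less_eq(3) order_trans)
qed

section \<open>A compact position\<close>

text \<open>
  Choose points of \<open>K\<close> as the columns of a matrix of maximal absolute determinant. By Cramer's
  rule, the coordinates of a point of \<open>K\<close> in this frame are quotients of two such
  determinants, so they lie between \<open>- 1\<close> and \<open>1\<close>.
\<close>

lemma max_volume_frame:
  fixes K :: "(real^'n) set"
  assumes "compact K" "interior K \<noteq> {}"
  obtains A :: "real^'n^'n" where "invertible A" "\<And>j. column j A \<in> K"
    "\<And>x k. A *v x \<in> K \<Longrightarrow> \<bar>x $ k\<bar> \<le> 1"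
proof -
  \<comment> \<open>the frames are the rows here, so that membership is componentwise; the final matrix is the transpose\<close>
  define T where "T = {X :: real^'n^'n. \<forall>j. X $ j \<in> K}"
  have "compact T"
  proof -
    have "T = (\<Inter>j. (\<lambda>X. X $ j) -` K)" by (auto simp: T_def)
    moreover have "closed \<dots>"
      using compact_imp_closed[OF assms(1)]
      by (intro closed_INT ballI closed_vimage continuous_intros)
    ultimately have "closed T" by simp
    obtain b where b: "\<And>x. x \<in> K \<Longrightarrow> norm x \<le> b"
      using compact_imp_bounded[OF assms(1)] unfolding bounded_iff by blast
    have "norm X \<le> (\<Sum>j\<in>(UNIV::'n set). b)" if "X \<in> T" for X
    proof -
      have "norm X \<le> (\<Sum>j\<in>UNIV. norm (X $ j))"
        unfolding norm_vec_def by (rule L2_set_le_sum) auto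
      also have "\<dots> \<le> (\<Sum>j\<in>(UNIV::'n set). b)"
        using that b by (intro sum_mono) (auto simp: T_def)
      finally show ?thesis .
    qed
    then have "bounded T" unfolding bounded_iff by blast
    with \<open>closed T\<close> show ?thesis by (simp add: compact_eq_bounded_closed)
  qed
  have "dim K = DIM(real^'n)"
    using assms(2) empty_interior_lowdim[of K] dim_subset_UNIV[of K] by (meson le_neq_implies_less)
  then have spanK: "span K = UNIV" by (simp only: dim_eq_full)
  obtain B where B: "B \<subseteq> K" "independent B" "K \<subseteq> span B" "card B = dim K"
    using basis_exists by blast
  have "span B = UNIV" using B(3) spanK by (metis span_mono span_span top.extremum_uniqueI)
  have "finite B" using B(2) independent_imp_finite by blast
  moreover have "card (UNIV :: 'n set) = card B" using B(4) \<open>dim K = DIM(real^'n)\<close> by simp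
  ultimately obtain f where f: "bij_betw f (UNIV :: 'n set) B"
    using finite_same_card_bij finite_class.finite_UNIV by blast
  define X0 where "X0 = (\<chi> j. f j)"
  have "rows X0 = B" using f by (auto simp: X0_def rows_def row_def bij_betw_def)
  then have "\<exists>Y. Y ** X0 = mat 1"
    using \<open>span B = UNIV\<close> matrix_left_invertible_span_rows[of X0] by simp
  then have det0: "det X0 \<noteq> 0" by (simp add: invertible_left_inverse flip: invertible_det_nz)
  have X0: "X0 \<in> T" using f B(1) by (auto simp: X0_def T_def bij_betw_def)
  have "continuous_on T (\<lambda>X. \<bar>det X\<bar>)"
    unfolding det_def by (intro continuous_intros)
  then obtain X where X: "X \<in> T" "\<And>Y. Y \<in> T \<Longrightarrow> \<bar>det Y\<bar> \<le> \<bar>det X\<bar>"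
    using continuous_attains_sup[OF \<open>compact T\<close>] X0 by blast
  have detX: "det X \<noteq> 0" using X(2)[OF X0] det0 by auto
  define A where "A = transpose X"
  have "invertible A" using detX by (simp add: A_def invertible_det_nz det_transpose)
  moreover have "column j A \<in> K" for j
    using X(1) by (simp add: A_def T_def column_def transpose_def)
  moreover have "\<bar>x $ k\<bar> \<le> 1" if "A *v x \<in> K" for x k
  proof -
    \<comment> \<open>exchange the \<open>k\<close>-th member of the frame for the point \<open>A *v x\<close> of \<open>K\<close>\<close>
    define Y where "Y = (\<chi> j. if j = k then A *v x else X $ j)"
    have "transpose Y = (\<chi> i j. if j = k then (A *v x) $ i else A $ i $ j)"
      by (simp add: Y_def A_def transpose_def vec_eq_iff)
    then have "det Y = x $ k * det A"
      using cramer_lemma[of k A x] by (metis det_transpose)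
    moreover have "\<bar>det Y\<bar> \<le> \<bar>det X\<bar>"
      using X(1) that by (intro X(2)) (auto simp: T_def Y_def)
    ultimately have "\<bar>x $ k\<bar> * \<bar>det X\<bar> \<le> 1 * \<bar>det X\<bar>"
      by (simp add: A_def det_transpose abs_mult)
    then show ?thesis using detX by (simp add: mult_le_cancel_right)
  qed
  ultimately show ?thesis using that by blast
qed

lemma lborel_eq_density_matrix:
  fixes A :: "real^'n^'n"
  assumes "det A \<noteq> 0"
  shows "lborel = density (distr lborel borel ((*v) A)) (\<lambda>_. ennreal \<bar>det A\<bar>)"
proof (rule measure_eqI)
  fix X :: "(real^'n) set" assume "X \<in> sets lborel"
  then have X: "X \<in> sets borel" by simp
  then have "emeasure (density (distr lborel borel ((*v) A)) (\<lambda>_. ennreal \<bar>det A\<bar>)) X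
      = (\<integral>\<^sup>+x. ennreal \<bar>det A\<bar> * indicator X x \<partial>distr lborel borel ((*v) A))"
    by (intro emeasure_density) auto
  also have "\<dots> = ennreal \<bar>det A\<bar> * (\<integral>\<^sup>+x. indicator X x \<partial>distr lborel borel ((*v) A))"
    using X by (intro nn_integral_cmult) auto
  also have "(\<integral>\<^sup>+x. indicator X x \<partial>distr lborel borel ((*v) A)) = (\<integral>\<^sup>+x. indicator X (A *v x) \<partial>lborel)"
    using X by (intro nn_integral_distr) auto
  also have "ennreal \<bar>det A\<bar> * \<dots> = (\<integral>\<^sup>+x. indicator X x \<partial>lborel)"
    using X by (intro nn_integral_linear_matrix[OF assms]) auto
  also have "\<dots> = emeasure lborel X" using X by simp
  finally show "emeasure lborel X = emeasure (density (distr lborel borel ((*v) A)) (\<lambda>_. ennreal \<bar>det A\<bar>)) X"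
    by (rule sym)
qed simp

lemma affine_change_centroid:
  fixes A :: "real^'n^'n"
  assumes \<phi>: "\<phi> \<in> Cvx_plus" and "invertible A" "centroid \<phi> = 0"
  shows "centroid (affine_change A c \<phi>) = 0"
proof -
  obtain B where B: "B ** A = mat 1" using assms(2) invertible_def by blast
  have d: "det A \<noteq> 0" using assms(2) by (simp add: invertible_det_nz)
  have [measurable]: "\<phi> \<in> borel_measurable borel" by (rule Cvx_plusD[OF \<phi>])
  let ?f = "density_fun \<phi>"
  have dens: "density_fun (affine_change A c \<phi>) x = exp (- c) * ?f (A *v x)" for x
    by (simp add: density_fun_def affine_change_def exp_neg_shift enn2real_mult)
  have "(\<integral>x. ?f x *\<^sub>R (B *v x) \<partial>lborel) = (\<integral>x. B *v (?f x *\<^sub>R x) \<partial>lborel)"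
    by (simp add: matrix_vector_mult_scaleR)
  also have "\<dots> = B *v (\<integral>x. ?f x *\<^sub>R x \<partial>lborel)"
    by (rule integral_bounded_linear) (auto intro: integrable_first_moment[OF \<phi>] simp: matrix_vector_mul_bounded_linear)
  also have "\<dots> = 0" using assms(3) centroid_eq_0_iff[OF \<phi>] by simp
  finally have 0: "(\<integral>x. ?f x *\<^sub>R (B *v x) \<partial>lborel) = 0" .
  have "(\<integral>x. ?f x *\<^sub>R (B *v x) \<partial>lborel)
      = (\<integral>x. ?f x *\<^sub>R (B *v x) \<partial>density (distr lborel borel ((*v) A)) (\<lambda>_. ennreal \<bar>det A\<bar>))"
    by (rule arg_cong[where f = "\<lambda>M. \<integral>x. ?f x *\<^sub>R (B *v x) \<partial>M"]) (rule lborel_eq_density_matrix[OF d])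
  also have "\<dots> = (\<integral>x. \<bar>det A\<bar> *\<^sub>R (?f x *\<^sub>R (B *v x)) \<partial>distr lborel borel ((*v) A))"
    by (rule integral_density) auto
  also have "\<dots> = (\<integral>x. \<bar>det A\<bar> *\<^sub>R (?f (A *v x) *\<^sub>R (B *v (A *v x))) \<partial>lborel)"
    by (rule integral_distr) auto
  also have "\<dots> = \<bar>det A\<bar> *\<^sub>R (\<integral>x. ?f (A *v x) *\<^sub>R x \<partial>lborel)"
    by (simp add: matrix_vector_mul_assoc B del: scaleR_scaleR)
  finally have "(\<integral>x. ?f (A *v x) *\<^sub>R x \<partial>lborel) = 0" using 0 d by simp
  then have "(\<integral>x. exp (- c) *\<^sub>R (?f (A *v x) *\<^sub>R x) \<partial>lborel) = 0"
    by (simp del: scaleR_scaleR)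
  then have "(\<integral>x. density_fun (affine_change A c \<phi>) x *\<^sub>R x \<partial>lborel) = 0"
    by (simp only: dens scaleR_scaleR)
  then show ?thesis using centroid_eq_0_iff[OF affine_change_Cvx_plus[OF \<phi> assms(2)]] by simp
qed

text \<open>
  A compact position. The bounds at the vertices of the standard simplex keep a function finite on a
  fixed ball, and the linear growth gives all such functions a common integrable majorant. The
  constants are those that \<open>normalized_affine_change\<close> produces.
\<close>

definition normalized :: "(real^'n \<Rightarrow> ereal) \<Rightarrow> bool" where
  "normalized \<phi> \<longleftrightarrow> (\<forall>i. \<phi> (axis i 1) \<le> 1) \<and> \<phi> 0 \<le> 1
     \<and> (\<forall>x. ereal (norm x / (CARD('n) + 1) - 2 * 2 ^ CARD('n)) \<le> \<phi> x)"

text \<open>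
  Apply \<open>max_volume_frame\<close> to the sublevel set one unit above the value at the origin. It contains
  the origin, and its image lies in a cube and contains the unit vectors. The lower
  bound by \<open>centroid_value_le\<close> controls the part inside the cube and \<open>convex_growth\<close> the rest.
\<close>

lemma normalized_affine_change:
  fixes \<phi> :: "real^'n \<Rightarrow> ereal"
  assumes \<phi>: "\<phi> \<in> Cvx_plus" and cen: "centroid \<phi> = 0"
  obtains A c where "invertible A" "normalized (affine_change A c \<phi>)"
proof -
  note D = Cvx_plusD[OF \<phi>]
  define k where "k = 2 * (2 ^ CARD('n) - 1 :: real)"
  have k: "\<phi> 0 \<le> ereal (m + k)" if "\<phi> x \<le> ereal m" for x m
    using centroid_value_le[OF \<phi> cen that] by (simp add: k_def)
  have k0: "k \<ge> 0" by (simp add: k_def)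
  obtain s p r where r: "r > 0" "ball p r \<subseteq> {x. \<phi> x \<le> ereal s}"
    using Cvx_plus_ball_sublevel[OF \<phi>] .
  have "\<phi> p \<le> ereal s" using r centre_in_ball by blast
  from k[OF this] D(4)[of 0] obtain c0 where c0: "\<phi> 0 = ereal c0" by (cases "\<phi> 0") auto
  define K where "K = {x. \<phi> x \<le> ereal (c0 + 1)}"
  have "closed K" unfolding K_def by (rule lsc_closed_sublevel[OF D(2)])
  obtain a C where a: "a > 0" and C: "\<And>x. ereal (a * norm x - C) \<le> \<phi> x"
    using Cvx_plus_coercive[OF \<phi>] by blast
  have "norm x \<le> (c0 + 1 + C) / a" if "x \<in> K" for x
  proof -
    have "a * norm x - C \<le> c0 + 1"
      using C[of x] that unfolding K_def by (metis ereal_less_eq(3) mem_Collect_eq order_trans)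
    then show ?thesis using a by (simp add: pos_le_divide_eq mult.commute)
  qed
  then have "bounded K" unfolding bounded_iff by blast
  with \<open>closed K\<close> have "compact K" by (simp add: compact_eq_bounded_closed)
  \<comment> \<open>contract the ball towards the origin until \<open>\<phi>\<close> is at most \<open>c0 + 1\<close> on it\<close>
  define l where "l = 1 / (1 + \<bar>s - c0\<bar>)"
  have l: "0 < l" "l \<le> 1" "l * (s - c0) \<le> 1" by (auto simp: l_def divide_le_eq)
  have "ball (l *\<^sub>R p) (l * r) \<subseteq> K"
  proof
    fix z assume z: "z \<in> ball (l *\<^sub>R p) (l * r)"
    define w where "w = (1 / l) *\<^sub>R z"
    have zw: "z = l *\<^sub>R w" using l by (simp add: w_def)
    have "dist (l *\<^sub>R p) (l *\<^sub>R w) = l * dist p w" using l by (simp add: dist_norm flip: scaleR_diff_right)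
    then have "dist p w < r" using z l by (simp add: zw)
    then have "\<phi> w \<le> ereal s" using r by auto
    then have "\<phi> (l *\<^sub>R w + (1 - l) *\<^sub>R 0) \<le> ereal (l * s + (1 - l) * c0)"
      by (rule ereal_convexD[OF D(3)]) (use l c0 in auto)
    also have "l * s + (1 - l) * c0 \<le> c0 + 1" using l(3) by (simp add: algebra_simps)
    finally show "z \<in> K" by (simp add: K_def zw)
  qed
  then have "interior K \<noteq> {}"
    using l r interior_maximal[OF _ open_ball, of "l *\<^sub>R p" "l * r" K] centre_in_ball[of "l *\<^sub>R p" "l * r"]
    by fastforce
  then obtain A :: "real^'n^'n" where A: "invertible A" "\<And>j. column j A \<in> K"
      "\<And>x k. A *v x \<in> K \<Longrightarrow> \<bar>x $ k\<bar> \<le> 1"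
    using max_volume_frame[OF \<open>compact K\<close>] by metis
  define \<psi> where "\<psi> = affine_change A (- c0) \<phi>"
  have \<psi>: "\<psi> x = \<phi> (A *v x) - ereal c0" for x
    by (cases "\<phi> (A *v x)") (auto simp: \<psi>_def affine_change_def)
  have \<psi>C: "\<psi> \<in> Cvx_plus" unfolding \<psi>_def by (rule affine_change_Cvx_plus[OF \<phi> A(1)])
  have \<psi>0: "\<psi> 0 = ereal 0" by (simp add: \<psi> c0)
  have lb: "ereal (- k) \<le> \<psi> x" for x
  proof (cases "\<phi> (A *v x)")
    case (real m)
    then have "c0 \<le> m + k" using k[of "A *v x" m] c0 by simp
    then show ?thesis using real by (simp add: \<psi>)
  next
    case MInf
    then show ?thesis using D(4) by simp
  qed (simp add: \<psi>)
  define R where "R = real CARD('n) + 1"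
  have R: "R > 0" by (simp add: R_def)
  have grow: "ereal (norm x / R) \<le> \<psi> x" if "R \<le> norm x" for x
  proof -
    have "ereal (0 + dist 0 x / R) \<le> \<psi> x"
    proof (rule convex_growth)
      show "ereal_convex \<psi>" by (rule Cvx_plusD[OF \<psi>C])
      show "\<psi> 0 \<le> ereal 0" using \<psi>0 by simp
      fix x assume "\<psi> x \<le> ereal (0 + 1)"
      then have "A *v x \<in> K" by (cases "\<phi> (A *v x)") (auto simp: K_def \<psi>)
      then have "\<bar>x $ i\<bar> \<le> 1" for i using A(3) by blast
      then have "(\<Sum>i\<in>UNIV. \<bar>x $ i\<bar>) \<le> (\<Sum>i\<in>(UNIV::'n set). 1)" by (intro sum_mono)
      then show "dist 0 x < R" using norm_le_l1_cart[of x] by (simp add: R_def)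
    qed (use R that in auto)
    then show ?thesis by simp
  qed
  have "ereal (norm x / R - 2 * 2 ^ CARD('n)) \<le> \<psi> x" for x
  proof (cases "R \<le> norm x")
    case True
    have "norm x / R - 2 * 2 ^ CARD('n) \<le> norm x / R" by simp
    then show ?thesis using grow[OF True] by (meson ereal_less_eq(3) order_trans)
  next
    case False
    then have "norm x / R \<le> 1" using R by simp
    then have "norm x / R - 2 * 2 ^ CARD('n) \<le> - k" by (simp add: k_def)
    then show ?thesis using lb[of x] by (meson ereal_less_eq(3) order_trans)
  qed
  moreover have "\<psi> (axis i 1) \<le> 1" for i
  proof -
    have "\<phi> (A *v axis i 1) \<le> ereal (c0 + 1)"
      using A(2)[of i] by (simp add: K_def matrix_vector_mult_basis)
    then show ?thesis unfolding \<psi> by (cases "\<phi> (A *v axis i 1)") (auto simp: one_ereal_def)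
  qed
  ultimately have "normalized \<psi>" using \<psi>0 by (auto simp: normalized_def R_def zero_ereal_def one_ereal_def add.commute)
  then show ?thesis using that A(1) unfolding \<psi>_def by blast
qed

section \<open>Epi-convergence\<close>

text \<open>
  Epigraphical (Gamma-) convergence, stated with open sets: eventually the values near \<open>x\<close> stay
  above every number smaller than \<open>f x\<close>, and eventually every neighbourhood of \<open>x\<close> contains a
  value below every number larger than \<open>f x\<close>. Unlike pointwise convergence, it has good compactness
  properties and it is compatible with minimization.
\<close>

definition epi_converges :: "(nat \<Rightarrow> 'a::topological_space \<Rightarrow> ereal) \<Rightarrow> ('a \<Rightarrow> ereal) \<Rightarrow> bool" where
  "epi_converges F f \<longleftrightarrow>
     (\<forall>x t. t < f x \<longrightarrow> (\<exists>U. open U \<and> x \<in> U \<and> (\<forall>\<^sub>F k in sequentially. \<forall>z\<in>U. t < F k z))) \<and>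
     (\<forall>x t U. f x < t \<longrightarrow> open U \<longrightarrow> x \<in> U \<longrightarrow> (\<forall>\<^sub>F k in sequentially. \<exists>z\<in>U. F k z < t))"

lemma epi_convergesD1:
  assumes "epi_converges F f" "t < f x"
  obtains U where "open U" "x \<in> U" "\<forall>\<^sub>F k in sequentially. \<forall>z\<in>U. t < F k z"
  using assms unfolding epi_converges_def by blast

lemma epi_convergesD2:
  assumes "epi_converges F f" "f x < t" "open U" "x \<in> U"
  shows "\<forall>\<^sub>F k in sequentially. \<exists>z\<in>U. F k z < t"
  using assms unfolding epi_converges_def by blast

text \<open>
  Along a diagonal subsequence the infima over all members of a countable base converge. The
  supremum of these limits over the basic sets around \<open>x\<close> is the value of the limit at \<open>x\<close>.
\<close>

lemma epi_compactness:
  fixes F :: "nat \<Rightarrow> 'a::second_countable_topology \<Rightarrow> ereal"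
  obtains r f where "strict_mono r" "epi_converges (F \<circ> r) f"
proof -
  obtain \<B> :: "'a set set" where \<B>: "countable \<B>" "topological_basis \<B>"
    using ex_countable_basis by blast
  define B where "B = from_nat_into \<B>"
  define h where "h = (\<lambda>k n. INF z\<in>B n. F k z)"
  interpret subseqs "\<lambda>n s. \<exists>l. (\<lambda>k. h (s k) n) \<longlonglongrightarrow> l"
  proof
    fix n and s :: "nat \<Rightarrow> nat"
    obtain l r where "strict_mono r" "((\<lambda>k. h (s k) n) \<circ> r) \<longlonglongrightarrow> l"
      using compact_complete_linorder[of "\<lambda>k. h (s k) n"] by blast
    then show "\<exists>r. strict_mono r \<and> (\<exists>l. (\<lambda>k. h ((s \<circ> r) k) n) \<longlonglongrightarrow> l)" by (auto simp: o_def)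
  qed
  have "\<exists>l. (\<lambda>k. h (diagseq k) n) \<longlonglongrightarrow> l" for n
  proof -
    have "\<exists>l. (\<lambda>k. h ((diagseq \<circ> (+) (Suc n)) k) n) \<longlonglongrightarrow> l"
    proof (rule diagseq_holds)
      fix r s :: "nat \<Rightarrow> nat" and n
      assume "strict_mono r" "\<exists>l. (\<lambda>k. h (s k) n) \<longlonglongrightarrow> l"
      then show "\<exists>l. (\<lambda>k. h ((s \<circ> r) k) n) \<longlonglongrightarrow> l"
        using LIMSEQ_subseq_LIMSEQ[of "\<lambda>k. h (s k) n" _ r] by (auto simp: o_def)
    qed
    then obtain l where "(\<lambda>k. h (diagseq (k + Suc n)) n) \<longlonglongrightarrow> l" by (auto simp: o_def add.commute)
    then have "(\<lambda>k. h (diagseq k) n) \<longlonglongrightarrow> l" by (rule LIMSEQ_offset)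
    then show ?thesis by blast
  qed
  then have "\<exists>L. \<forall>n. (\<lambda>k. h (diagseq k) n) \<longlonglongrightarrow> L n" by (intro choice allI)
  then obtain L where L: "\<And>n. (\<lambda>k. h (diagseq k) n) \<longlonglongrightarrow> L n" by blast
  define f where "f = (\<lambda>x. SUP n\<in>{n. open (B n) \<and> x \<in> B n}. L n)"
  have "epi_converges (F \<circ> diagseq) f"
    unfolding epi_converges_def
  proof (intro conjI allI impI)
    fix x t assume "t < f x"
    then obtain n where n: "open (B n)" "x \<in> B n" "t < L n" by (auto simp: f_def less_SUP_iff)
    have "\<forall>\<^sub>F k in sequentially. t < h (diagseq k) n" by (rule order_tendstoD(1)[OF L n(3)])
    then have "\<forall>\<^sub>F k in sequentially. \<forall>z\<in>B n. t < (F \<circ> diagseq) k z"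
      by eventually_elim (auto simp: h_def dest: less_INF_D)
    then show "\<exists>U. open U \<and> x \<in> U \<and> (\<forall>\<^sub>F k in sequentially. \<forall>z\<in>U. t < (F \<circ> diagseq) k z)"
      using n by blast
  next
    fix x t U assume x: "f x < t" "open U" "x \<in> U"
    obtain b where b: "b \<in> \<B>" "x \<in> b" "b \<subseteq> U" using topological_basisE[OF \<B>(2) x(2,3)] .
    obtain n where n: "B n = b" using from_nat_into_surj[OF \<B>(1) b(1)] by (auto simp: B_def)
    have "open (B n)" using topological_basis_open[OF \<B>(2) b(1)] n by simp
    then have "L n \<le> f x" unfolding f_def using b n by (intro SUP_upper) auto
    then have "L n < t" using x by simp
    have "\<forall>\<^sub>F k in sequentially. h (diagseq k) n < t" by (rule order_tendstoD(2)[OF L \<open>L n < t\<close>])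
    then show "\<forall>\<^sub>F k in sequentially. \<exists>z\<in>U. (F \<circ> diagseq) k z < t"
      by eventually_elim (use b n in \<open>auto simp: h_def INF_less_iff\<close>)
  qed
  then show ?thesis using that subseq_diagseq by blast
qed

lemma epi_converges_eventually_greater:
  assumes "epi_converges F f" "t < f x"
  shows "\<forall>\<^sub>F k in sequentially. t < F k x"
proof -
  obtain U where "open U" "x \<in> U" and U: "\<forall>\<^sub>F k in sequentially. \<forall>z\<in>U. t < F k z"
    using epi_convergesD1[OF assms] .
  show ?thesis using U by eventually_elim (use \<open>x \<in> U\<close> in blast)
qed

lemma epi_limit_le:
  assumes "epi_converges F f" "\<And>k. F k x \<le> t"
  shows "f x \<le> t"
proof (rule ccontr)
  assume "\<not> f x \<le> t"
  then have "\<forall>\<^sub>F k in sequentially. t < F k x"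
    by (intro epi_converges_eventually_greater[OF assms(1)]) auto
  then have "\<exists>k. t < F k x" by (auto dest: eventually_happens)
  then show False using assms(2) by (meson not_le)
qed

lemma epi_limit_ge:
  assumes ec: "epi_converges F f" and l: "continuous_on UNIV l" and F: "\<And>k x. ereal (l x) \<le> F k x"
  shows "ereal (l x) \<le> f x"
proof (rule ccontr)
  assume "\<not> ereal (l x) \<le> f x"
  then obtain t where t: "f x < ereal t" "t < l x"
    using ereal_dense2[of "f x" "ereal (l x)"] by (auto simp: not_le)
  have "open (l -` {t<..})" by (intro open_vimage l) auto
  from epi_convergesD2[OF ec t(1) this]
  have "\<forall>\<^sub>F k in sequentially. \<exists>z\<in>l -` {t<..}. F k z < ereal t" using t by simp
  then obtain k z where "t < l z" "F k z < ereal t" by (auto dest: eventually_happens)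
  then have "F k z < ereal (l z)" by (meson less_ereal.simps(1) less_trans)
  then show False using F[of z k] by simp
qed

lemma epi_limit_lsc:
  assumes ec: "epi_converges F f"
  shows "lower_semicontinuous f"
  unfolding lsc_iff_open
proof (intro allI, subst open_subopen, safe)
  fix t x assume "t < f x"
  then obtain t' where t': "t < t'" "t' < f x" using dense by blast
  obtain U where U: "open U" "x \<in> U" "\<forall>\<^sub>F k in sequentially. \<forall>z\<in>U. t' < F k z"
    using epi_convergesD1[OF ec t'(2)] .
  have "t' \<le> f w" if "w \<in> U" for w
  proof (rule ccontr)
    assume "\<not> t' \<le> f w"
    then have "\<forall>\<^sub>F k in sequentially. \<exists>z\<in>U. F k z < t'"
      using epi_convergesD2[OF ec _ U(1) that] by simp
    with U(3) have "\<forall>\<^sub>F k in sequentially. False"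
      by eventually_elim force
    then show False by simp
  qed
  then show "\<exists>T. open T \<and> x \<in> T \<and> T \<subseteq> {x. t < f x}"
    using U t' by (intro exI[of _ U]) (auto intro: less_le_trans)
qed

lemma epi_limit_convex:
  fixes F :: "nat \<Rightarrow> 'a::real_normed_vector \<Rightarrow> ereal"
  assumes ec: "epi_converges F f" and cv: "\<And>k. ereal_convex (F k)" and ninf: "\<And>x. f x \<noteq> -\<infinity>"
  shows "ereal_convex f"
proof (rule ereal_convexI[OF ninf], rule ccontr)
  fix x y s t and u v :: real
  assume st: "f x < ereal s" "f y < ereal t" and uv: "u > 0" "v > 0" "u + v = 1"
    and "\<not> f (u *\<^sub>R x + v *\<^sub>R y) \<le> ereal (u * s + v * t)"
  then have "ereal (u * s + v * t) < f (u *\<^sub>R x + v *\<^sub>R y)" by simp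
  then obtain U where U: "open U" "u *\<^sub>R x + v *\<^sub>R y \<in> U"
      "\<forall>\<^sub>F k in sequentially. \<forall>z\<in>U. ereal (u * s + v * t) < F k z"
    by (rule epi_convergesD1[OF ec])
  obtain e where e: "e > 0" "ball (u *\<^sub>R x + v *\<^sub>R y) e \<subseteq> U" using U open_contains_ball by blast
  have "\<forall>\<^sub>F k in sequentially. \<exists>z\<in>ball x e. F k z < ereal s"
    "\<forall>\<^sub>F k in sequentially. \<exists>z\<in>ball y e. F k z < ereal t"
    using e(1) by (simp_all add: epi_convergesD2[OF ec st(1)] epi_convergesD2[OF ec st(2)])
  with U(3) have "\<forall>\<^sub>F k in sequentially. False"
  proof eventually_elim
    case (elim k)
    then obtain z w where zw: "dist x z < e" "F k z < ereal s" "dist y w < e" "F k w < ereal t" by auto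
    have "dist (u *\<^sub>R x + v *\<^sub>R y) (u *\<^sub>R z + v *\<^sub>R w) = norm (u *\<^sub>R (x - z) + v *\<^sub>R (y - w))"
      by (simp add: dist_norm algebra_simps)
    also have "\<dots> \<le> u * dist x z + v * dist y w"
      using uv norm_triangle_ineq[of "u *\<^sub>R (x - z)" "v *\<^sub>R (y - w)"] by (simp add: dist_norm)
    also have "\<dots> < u * e + v * e"
      using zw uv by (intro add_strict_mono mult_strict_left_mono) auto
    also have "\<dots> = e" using uv by (simp flip: distrib_right)
    finally have "u *\<^sub>R z + v *\<^sub>R w \<in> U" using e by auto
    then have "ereal (u * s + v * t) < F k (u *\<^sub>R z + v *\<^sub>R w)" using elim by blast
    moreover have "F k (u *\<^sub>R z + v *\<^sub>R w) \<le> ereal (u * s + v * t)"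
      using zw uv by (intro ereal_convexD[OF cv]) auto
    ultimately show False by simp
  qed
  then show False by simp
qed

lemma epi_limit_even:
  fixes F :: "nat \<Rightarrow> real ^ 'n \<Rightarrow> ereal"
  assumes ec: "epi_converges F f" and ev: "\<And>k. even_fun (F k)"
  shows "even_fun f"
proof -
  have le: "f (- x) \<le> f x" for x
  proof (rule ccontr)
    assume "\<not> f (- x) \<le> f x"
    then obtain t where t: "f x < t" "t < f (- x)" using dense[of "f x" "f (- x)"] by (auto simp: not_le)
    obtain U where U: "open U" "- x \<in> U" "\<forall>\<^sub>F k in sequentially. \<forall>z\<in>U. t < F k z"
      using epi_convergesD1[OF ec t(2)] .
    have "open (uminus -` U)" using U(1) by (intro open_vimage continuous_intros)
    then have "\<forall>\<^sub>F k in sequentially. \<exists>z\<in>uminus -` U. F k z < t"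
      using U(2) by (intro epi_convergesD2[OF ec t(1)]) auto
    with U(3) have "\<forall>\<^sub>F k in sequentially. False"
    proof eventually_elim
      case (elim k)
      then obtain z where z: "- z \<in> U" "F k z < t" by auto
      then have "t < F k (- z)" using elim by blast
      then show False using z ev[of k] by (simp add: even_fun_def)
    qed
    then show False by simp
  qed
  have "f (- x) = f x" for x using le[of x] le[of "- x"] by simp
  then show ?thesis by (simp add: even_fun_def)
qed

text \<open>
  The strict lower bound holds on a neighbourhood of each point from some index on, and finitely
  many neighbourhoods cover the compact set. The varying bound \<open>l\<close> is needed for the linear
  functions in the Legendre transform.
\<close>

lemma epi_converges_compact:
  assumes ec: "epi_converges F f" and K: "compact K" and l: "continuous_on UNIV l"
    and less: "\<And>z. z \<in> K \<Longrightarrow> ereal (l z) < f z"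
  shows "\<forall>\<^sub>F k in sequentially. \<forall>z\<in>K. ereal (l z) < F k z"
proof -
  have "\<exists>V. open V \<and> z \<in> V \<and> (\<forall>\<^sub>F k in sequentially. \<forall>w\<in>V. ereal (l w) < F k w)" if z: "z \<in> K" for z
  proof -
    obtain t where t: "l z < t" "ereal t < f z"
      using ereal_dense2[OF less[OF z]] by auto
    obtain U where U: "open U" "z \<in> U" "\<forall>\<^sub>F k in sequentially. \<forall>w\<in>U. ereal t < F k w"
      using epi_convergesD1[OF ec t(2)] .
    have "open (l -` {..<t})" by (intro open_vimage l) auto
    then have "open (U \<inter> l -` {..<t})" using U(1) by blast
    moreover from U(3) have "\<forall>\<^sub>F k in sequentially. \<forall>w\<in>U \<inter> l -` {..<t}. ereal (l w) < F k w"
      by eventually_elim (auto intro: less_trans[of _ "ereal t"])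
    ultimately show ?thesis using U(2) t(1) by (intro exI[of _ "U \<inter> l -` {..<t}"]) auto
  qed
  then obtain V where V: "\<And>z. z \<in> K \<Longrightarrow> open (V z)" "\<And>z. z \<in> K \<Longrightarrow> z \<in> V z"
      "\<And>z. z \<in> K \<Longrightarrow> \<forall>\<^sub>F k in sequentially. \<forall>w\<in>V z. ereal (l w) < F k w"
    by metis
  obtain K' where K': "K' \<subseteq> K" "finite K'" "K \<subseteq> (\<Union>z\<in>K'. V z)"
    by (rule compactE_image[OF K, of K V]) (use V(1,2) in auto)
  have "\<forall>\<^sub>F k in sequentially. \<forall>z\<in>K'. \<forall>w\<in>V z. ereal (l w) < F k w"
    using K' V(3) by (intro eventually_ball_finite) auto
  then show ?thesis
  proof eventually_elim
    case (elim k)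
    show ?case
    proof
      fix z assume "z \<in> K"
      then obtain w where "w \<in> K'" "z \<in> V w" using K'(3) by blast
      then show "ereal (l z) < F k z" using elim by blast
    qed
  qed
qed

text \<open>
  Prolong the segment from \<open>p\<close> to \<open>x\<close> a little beyond \<open>x\<close>, to a point \<open>y\<close> of the domain. Near
  \<open>y\<close> there are points with bounded values, and the convex hull of such a point and the
  given ball around \<open>p\<close> covers a fixed ball around \<open>x\<close>.
\<close>

lemma epi_locally_bounded:
  fixes F :: "nat \<Rightarrow> 'a::real_normed_vector \<Rightarrow> ereal"
  assumes ec: "epi_converges F f" and cv: "\<And>k. ereal_convex (F k)"
    and r: "r > 0" and s: "\<And>k z. z \<in> ball p r \<Longrightarrow> F k z \<le> ereal s"
    and x: "x \<in> interior {x. f x < \<infinity>}"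
  shows "\<exists>M. \<exists>e>0. \<forall>\<^sub>F k in sequentially. \<forall>w\<in>ball x e. F k w \<le> ereal M"
proof -
  obtain e0 where e0: "e0 > 0" "ball x e0 \<subseteq> {x. f x < \<infinity>}" using x by (auto simp: mem_interior)
  define \<epsilon> where "\<epsilon> = e0 / (2 * (1 + norm (x - p)))"
  have n1: "1 + norm (x - p) > 0" by (smt (verit) norm_ge_zero)
  have \<epsilon>: "\<epsilon> > 0" using e0 n1 by (simp add: \<epsilon>_def)
  define y where "y = x + \<epsilon> *\<^sub>R (x - p)"
  have "dist x y = \<epsilon> * norm (x - p)" using \<epsilon> by (simp add: y_def dist_norm)
  also have "\<dots> \<le> \<epsilon> * (1 + norm (x - p))" using \<epsilon> by simp
  also have "\<dots> = e0 / 2" using n1 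
    by (simp add: \<epsilon>_def nonzero_divide_eq_eq)
  finally have "y \<in> ball x e0" using e0(1) by simp
  then have "f y < \<infinity>" using e0(2) by blast
  then obtain M1 where M1: "f y < ereal M1"
    using ereal_dense2 by blast
  define M where "M = max M1 s"
  have M: "f y < ereal M" "s \<le> M"
    using less_le_trans[OF M1, of "ereal M"] by (auto simp: M_def)
  \<comment> \<open>the weight for which \<open>x\<close> is the convex combination of \<open>y\<close> and \<open>p\<close>\<close>
  define l where "l = \<epsilon> / (1 + \<epsilon>)"
  have l: "0 < l" "l < 1" using \<epsilon> by (auto simp: l_def)
  have "(1 - l) *\<^sub>R y + l *\<^sub>R p = x"
  proof -
    have "(1 - l) * (1 + \<epsilon>) = 1" "(1 - l) * \<epsilon> = l" using \<epsilon> by (auto simp: l_def field_simps)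
    moreover have "(1 - l) *\<^sub>R y + l *\<^sub>R p = ((1 - l) * (1 + \<epsilon>)) *\<^sub>R x + (l - (1 - l) * \<epsilon>) *\<^sub>R p"
      by (simp add: y_def algebra_simps)
    ultimately show ?thesis by simp
  qed
  note xeq = this
  define e where "e = l * r / 2"
  have e: "e > 0" using l r by (simp add: e_def)
  have "\<forall>\<^sub>F k in sequentially. \<exists>z\<in>ball y e. F k z < ereal M"
    using e by (intro epi_convergesD2[OF ec M(1)]) auto
  then have "\<forall>\<^sub>F k in sequentially. \<forall>w\<in>ball x e. F k w \<le> ereal M"
  proof eventually_elim
    case (elim k)
    then obtain z where z: "dist y z < e" "F k z < ereal M" by auto
    show ?case
    proof
      fix w assume w: "w \<in> ball x e"
      \<comment> \<open>the point of the given ball that, combined with \<open>z\<close>, yields \<open>w\<close>\<close>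
      define v where "v = (1 / l) *\<^sub>R (w - (1 - l) *\<^sub>R z)"
      have weq: "(1 - l) *\<^sub>R z + l *\<^sub>R v = w" using l by (simp add: v_def)
      have "l *\<^sub>R (v - p) = (w - x) + (1 - l) *\<^sub>R (y - z)"
        unfolding weq[symmetric] by (subst xeq[symmetric]) (simp add: algebra_simps)
      then have "norm (l *\<^sub>R (v - p)) = norm ((w - x) + (1 - l) *\<^sub>R (y - z))" by (rule arg_cong)
      then have "l * norm (v - p) = norm ((w - x) + (1 - l) *\<^sub>R (y - z))"
        using l by simp
      also have "\<dots> \<le> norm (w - x) + (1 - l) * norm (y - z)"
        using norm_triangle_ineq[of "w - x" "(1 - l) *\<^sub>R (y - z)"] l by simp
      also have "\<dots> \<le> norm (w - x) + norm (y - z)"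
        using l by (simp add: mult_left_le_one_le)
      also have "\<dots> < e + e" using w z by (intro add_strict_mono) (auto simp: dist_norm norm_minus_commute)
      also have "\<dots> = l * r" by (simp add: e_def)
      finally have "norm (v - p) < r" using l by simp
      then have "F k v \<le> ereal s" by (intro s) (simp add: dist_norm norm_minus_commute)
      then have "F k v \<le> ereal M" using M(2) by (meson ereal_less_eq(3) order_trans)
      then have "F k ((1 - l) *\<^sub>R z + l *\<^sub>R v) \<le> ereal ((1 - l) * M + l * M)"
        using z l by (intro ereal_convexD[OF cv]) auto
      then show "F k w \<le> ereal M" unfolding weq by (simp add: algebra_simps)
    qed
  qed
  then show ?thesis using e by blast
qed

text \<open>
  Off the frontier of its domain, the limit is attained pointwise. The lower bound is part of
  epi-convergence and settles points with infinite limit. At an interior point, \<open>x\<close> is a convex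
  combination of a recovery point very close to \<open>x\<close> and, with small weight, a point where the
  functions are bounded by \<open>epi_locally_bounded\<close>.
\<close>

lemma epi_converges_pointwise:
  fixes F :: "nat \<Rightarrow> 'a::real_normed_vector \<Rightarrow> ereal"
  assumes ec: "epi_converges F f" and cv: "\<And>k. ereal_convex (F k)"
    and r: "r > 0" and s: "\<And>k z. z \<in> ball p r \<Longrightarrow> F k z \<le> ereal s"
    and x: "x \<notin> frontier {x. f x < \<infinity>}"
  shows "(\<lambda>k. F k x) \<longlonglongrightarrow> f x"
proof (rule order_tendstoI)
  fix t assume "t < f x"
  then show "\<forall>\<^sub>F k in sequentially. t < F k x" by (rule epi_converges_eventually_greater[OF ec])
next
  fix t assume t: "f x < t"
  have "f x < \<infinity>" by (rule less_le_trans[OF t]) simp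
  then have "x \<in> closure {x. f x < \<infinity>}" by (intro subsetD[OF closure_subset]) simp
  then have "x \<in> interior {x. f x < \<infinity>}" using x by (simp add: frontier_def)
  then obtain M e where e: "e > 0" and M: "\<forall>\<^sub>F k in sequentially. \<forall>w\<in>ball x e. F k w \<le> ereal M"
    using epi_locally_bounded[where x = x, OF ec cv r s] by blast
  obtain t2 where t2: "f x < ereal t2" "ereal t2 < t" using ereal_dense2[OF t] by blast
  obtain t1 where t1: "f x < ereal t1" "ereal t1 < ereal t2" using ereal_dense2[OF t2(1)] by blast
  \<comment> \<open>a weight so small that the bound \<open>M\<close> raises \<open>t1\<close> to at most \<open>t2\<close>\<close>
  define m where "m = (t2 - t1) / (t2 - t1 + \<bar>M - t1\<bar>)"
  have t12: "t2 - t1 > 0" using t1 by simp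
  have d: "t2 - t1 + \<bar>M - t1\<bar> > 0" using t12 by linarith
  have m: "0 < m" "m \<le> 1" using t12 d unfolding m_def by (simp_all add: divide_le_eq_1)
  have "m * (t2 - t1 + \<bar>M - t1\<bar>) = t2 - t1" using d unfolding m_def by simp
  moreover have "m * \<bar>M - t1\<bar> \<le> m * (t2 - t1 + \<bar>M - t1\<bar>)"
    using m(1) t12 by (intro mult_left_mono) linarith+
  ultimately have "m * \<bar>M - t1\<bar> \<le> t2 - t1" by linarith
  moreover have "m * (M - t1) \<le> m * \<bar>M - t1\<bar>" using m by (intro mult_left_mono) auto
  ultimately have mM: "(1 - m) * t1 + m * M \<le> t2" by (simp add: algebra_simps)
  have "\<forall>\<^sub>F k in sequentially. \<exists>z\<in>ball x (m * e). F k z < ereal t1"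
    using m e by (intro epi_convergesD2[OF ec t1(1)]) auto
  with M show "\<forall>\<^sub>F k in sequentially. F k x < t"
  proof eventually_elim
    case (elim k)
    then obtain z where z: "dist x z < m * e" "F k z < ereal t1" by auto
    define w where "w = (1 / m) *\<^sub>R (x - (1 - m) *\<^sub>R z)"
    have xeq: "(1 - m) *\<^sub>R z + m *\<^sub>R w = x" using m by (simp add: w_def)
    have "m *\<^sub>R (w - x) = (1 - m) *\<^sub>R (x - z)" using xeq by (simp add: algebra_simps)
    then have "norm (m *\<^sub>R (w - x)) = norm ((1 - m) *\<^sub>R (x - z))" by (rule arg_cong)
    then have "m * norm (w - x) = (1 - m) * norm (x - z)"
      using m by simp
    also have "\<dots> \<le> norm (x - z)" using m by (intro mult_left_le_one_le) auto
    also have "\<dots> < m * e" using z by (simp add: dist_norm)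
    finally have "norm (w - x) < e" using m(1) by (simp only: mult_less_cancel_left_pos)
    then have "w \<in> ball x e" by (simp add: dist_norm norm_minus_commute)
    then have "F k w \<le> ereal M" using elim(1) by blast
    from z(2) this have "F k ((1 - m) *\<^sub>R z + m *\<^sub>R w) \<le> ereal ((1 - m) * t1 + m * M)"
      by (intro ereal_convexD[OF cv]) (use m in auto)
    also have "\<dots> \<le> ereal t2" using mM by simp
    finally have "F k x \<le> ereal t2" by (simp only: xeq)
    then show "F k x < t" using t2(2) by (rule le_less_trans)
  qed
qed

text \<open>
  Slightly tilted affine functions still have finite Legendre transform, so \<open>f\<close> minus the linear
  function \<open>y\<close> grows linearly along every coordinate direction.
\<close>

lemma legendre_interior_sublevel_bounded:
  fixes f :: "real^'n \<Rightarrow> ereal"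
  assumes y: "y \<in> interior {y. legendre f y < \<infinity>}"
  shows "bounded {x. f x \<le> ereal (x \<bullet> y + s)}"
proof -
  obtain e where e: "e > 0" "ball y e \<subseteq> {y. legendre f y < \<infinity>}" using y by (auto simp: mem_interior)
  have "\<exists>C. \<forall>x. f x \<le> ereal (x \<bullet> y + s) \<longrightarrow> x \<bullet> b \<le> C" if b: "norm b = 1" for b
  proof -
    have "y + (e / 2) *\<^sub>R b \<in> ball y e" using b e by (simp add: dist_norm)
    then have "legendre f (y + (e / 2) *\<^sub>R b) < \<infinity>" using e by blast
    then obtain C where C: "\<And>x. ereal (x \<bullet> (y + (e / 2) *\<^sub>R b) - C) \<le> f x"
      unfolding ereal_less_infinity_iff legendre_le_iff by blast
    have "x \<bullet> b \<le> (s + C) * 2 / e" if "f x \<le> ereal (x \<bullet> y + s)" for x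
    proof -
      have "x \<bullet> (y + (e / 2) *\<^sub>R b) - C \<le> x \<bullet> y + s"
        using order_trans[OF C that] by simp
      then show ?thesis using e by (simp add: algebra_simps field_simps)
    qed
    then show ?thesis by blast
  qed
  then have "\<exists>C. \<forall>x. f x \<le> ereal (x \<bullet> y + s) \<longrightarrow> \<bar>x $ i\<bar> \<le> C" for i
  proof -
    assume *: "\<And>b. norm b = 1 \<Longrightarrow> \<exists>C. \<forall>x. f x \<le> ereal (x \<bullet> y + s) \<longrightarrow> x \<bullet> b \<le> C"
    obtain C where "\<And>x. f x \<le> ereal (x \<bullet> y + s) \<Longrightarrow> x \<bullet> axis i 1 \<le> C" using *[of "axis i 1"] by auto
    moreover obtain D where "\<And>x. f x \<le> ereal (x \<bullet> y + s) \<Longrightarrow> x \<bullet> - axis i 1 \<le> D" using *[of "- axis i 1"] by auto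
    ultimately have "\<bar>x $ i\<bar> \<le> max C D" if "f x \<le> ereal (x \<bullet> y + s)" for x
      using that by (force simp: inner_axis abs_le_iff le_max_iff_disj)
    then show ?thesis by blast
  qed
  then obtain C where C: "\<And>i x. f x \<le> ereal (x \<bullet> y + s) \<Longrightarrow> \<bar>x $ i\<bar> \<le> C i" by metis
  have "norm x \<le> sum C UNIV" if "f x \<le> ereal (x \<bullet> y + s)" for x
    using norm_le_l1_cart[of x] sum_mono[of UNIV "\<lambda>i. \<bar>x $ i\<bar>" C] C[OF that] by force
  then show ?thesis unfolding bounded_iff by blast
qed

text \<open>
  This is the half of the continuity of the Legendre transform that a lower bound of the dual
  integral needs: no mass of the suprema may escape to infinity. Tilted by \<open>y\<close>, the limit is large
  on a sphere around \<open>p\<close>, hence so are eventually the members of the sequence. As they are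
  bounded at \<open>p\<close>, convexity keeps them large outside the sphere, and inside it
  \<open>epi_converges_compact\<close> applies.
\<close>

lemma epi_converges_legendre:
  fixes F :: "nat \<Rightarrow> real^'n \<Rightarrow> ereal"
  assumes ec: "epi_converges F f" and cv: "\<And>k. ereal_convex (F k)"
    and s: "\<And>k. F k p \<le> ereal s"
    and y: "y \<in> interior {y. legendre f y < \<infinity>}" and t: "legendre f y < ereal t"
  shows "\<forall>\<^sub>F k in sequentially. legendre (F k) y \<le> ereal t"
proof -
  \<comment> \<open>after tilting by \<open>y\<close>: the level to be reached, and the known upper bound at the centre \<open>p\<close>\<close>
  define \<sigma> where "\<sigma> = max (- t) (s - p \<bullet> y)"
  obtain R0 where R0: "\<And>x. f x \<le> ereal (x \<bullet> y + \<sigma>) \<Longrightarrow> dist p x \<le> R0"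
    using legendre_interior_sublevel_bounded[OF y, of \<sigma>] unfolding bounded_any_center[of _ p] by auto
  define R where "R = \<bar>R0\<bar> + 1"
  have R: "R > 0" by (simp add: R_def)
  have "ereal (z \<bullet> y + \<sigma>) < f z" if "z \<in> sphere p R" for z
  proof (rule ccontr)
    assume "\<not> ereal (z \<bullet> y + \<sigma>) < f z"
    then have "dist p z \<le> R0" by (intro R0) simp
    then show False using that by (simp add: R_def)
  qed
  then have E1: "\<forall>\<^sub>F k in sequentially. \<forall>z\<in>sphere p R. ereal (z \<bullet> y + \<sigma>) < F k z"
    by (intro epi_converges_compact[OF ec]) (auto intro!: continuous_intros)
  have "ereal (z \<bullet> y - t) < f z" for z
  proof -
    have "ereal (z \<bullet> y) - f z \<le> legendre f y" unfolding legendre_def by (rule SUP_upper) simp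
    then have "ereal (z \<bullet> y) - f z < ereal t" using t by simp
    then show ?thesis by (cases "f z") auto
  qed
  then have E2: "\<forall>\<^sub>F k in sequentially. \<forall>z\<in>cball p R. ereal (z \<bullet> y - t) < F k z"
    by (intro epi_converges_compact[OF ec]) (auto intro!: continuous_intros)
  from E1 E2 show ?thesis
  proof eventually_elim
    case (elim k)
    have "ereal (x \<bullet> y - t) \<le> F k x" for x
    proof (cases "dist p x \<le> R")
      case True
      then show ?thesis using elim(2) by (auto intro: less_imp_le)
    next
      case False
      show ?thesis
      proof (rule ccontr)
        assume "\<not> ereal (x \<bullet> y - t) \<le> F k x"
        then have Fx: "F k x \<le> ereal (x \<bullet> y - t)" by simp
        \<comment> \<open>the weight of \<open>x\<close> at the point of the sphere on the segment from \<open>p\<close> to \<open>x\<close>\<close>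
        define q where "q = R / dist p x"
        have d: "dist p x > 0" using R False by linarith
        have q: "0 < q" "q \<le> 1" using R False d by (simp_all add: q_def)
        define z where "z = (1 - q) *\<^sub>R p + q *\<^sub>R x"
        have "p - z = q *\<^sub>R (p - x)" by (simp add: z_def algebra_simps)
        then have "dist p z = q * dist p x" using q by (simp add: dist_norm)
        then have "z \<in> sphere p R" using d by (simp add: q_def)
        then have "ereal (z \<bullet> y + \<sigma>) < F k z" using elim(1) by blast
        also have "F k z \<le> ereal ((1 - q) * s + q * (x \<bullet> y - t))"
          unfolding z_def by (rule ereal_convexD[OF cv s Fx]) (use q in auto)
        finally have "z \<bullet> y + \<sigma> < (1 - q) * s + q * (x \<bullet> y - t)" by simp
        also have "\<dots> \<le> (1 - q) * (p \<bullet> y + \<sigma>) + q * (x \<bullet> y + \<sigma>)"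
          using q by (intro add_mono mult_left_mono) (auto simp: \<sigma>_def)
        also have "\<dots> = z \<bullet> y + \<sigma>" by (simp add: z_def algebra_simps)
        finally show False by simp
      qed
    qed
    then show ?case by (simp add: legendre_le_iff)
  qed
qed

section \<open>Existence of minimizers\<close>

lemma normalized_ball:
  "\<exists>p r. r > 0 \<and> (\<forall>\<phi> :: real^'n \<Rightarrow> ereal. ereal_convex \<phi> \<longrightarrow> normalized \<phi> \<longrightarrow> (\<forall>z\<in>ball p r. \<phi> z \<le> 1))"
proof -
  obtain p :: "real^'n" where "p \<in> interior (convex hull (insert 0 Basis))"
    using interior_std_simplex_nonempty .
  then obtain r where r: "r > 0" "ball p r \<subseteq> convex hull (insert 0 Basis)"
    unfolding mem_interior by blast
  have "\<phi> z \<le> 1" if \<phi>: "ereal_convex \<phi>" "normalized \<phi>" and z: "z \<in> ball p r" for \<phi> and z :: "real^'n"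
  proof -
    have "convex hull (insert 0 Basis) \<subseteq> {x. \<phi> x \<le> ereal 1}"
    proof (rule hull_minimal)
      show "insert 0 Basis \<subseteq> {x. \<phi> x \<le> ereal 1}"
        using \<phi>(2) by (auto simp: normalized_def Basis_vec_def one_ereal_def)
    qed (rule ereal_convex_sublevel[OF \<phi>(1)])
    then show ?thesis using r(2) z by (auto simp: one_ereal_def)
  qed
  then show ?thesis using r(1) by blast
qed

lemma exp_neg_legendre_le_liminf:
  fixes F :: "nat \<Rightarrow> real^'n \<Rightarrow> ereal"
  assumes ec: "epi_converges F f" and cv: "\<And>k. ereal_convex (F k)"
    and s: "\<And>k. F k p \<le> ereal s" and y: "y \<notin> frontier {y. legendre f y < \<infinity>}"
  shows "exp_neg (legendre f y) \<le> liminf (\<lambda>k. exp_neg (legendre (F k) y))"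
proof (cases "legendre f y")
  case (real r)
  then have "y \<in> closure {y. legendre f y < \<infinity>}" by (intro subsetD[OF closure_subset]) simp
  then have int: "y \<in> interior {y. legendre f y < \<infinity>}" using y by (simp add: frontier_def)
  have le: "exp_neg (ereal (r + inverse (Suc n))) \<le> liminf (\<lambda>k. exp_neg (legendre (F k) y))" for n
  proof (rule Liminf_bounded)
    have "\<forall>\<^sub>F k in sequentially. legendre (F k) y \<le> ereal (r + inverse (Suc n))"
      by (rule epi_converges_legendre[OF ec cv s int]) (simp add: real)
    then show "\<forall>\<^sub>F k in sequentially. exp_neg (ereal (r + inverse (Suc n))) \<le> exp_neg (legendre (F k) y)"
      by eventually_elim (rule exp_neg_antimono)
  qed
  have "(\<lambda>n. ereal (r + inverse (Suc n))) \<longlonglongrightarrow> ereal r"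
    using LIMSEQ_inverse_real_of_nat_add[of r] by simp
  then have "(\<lambda>n. exp_neg (ereal (r + inverse (Suc n)))) \<longlonglongrightarrow> exp_neg (ereal r)"
    by (rule tendsto_exp_neg)
  then show ?thesis unfolding real by (rule LIMSEQ_le_const2) (use le in blast)
next
  case PInf
  then show ?thesis by simp
next
  case MInf
  have "f p \<le> ereal s" by (rule epi_limit_le[OF ec s])
  then have "ereal (p \<bullet> y - s) \<le> ereal (p \<bullet> y) - f p" by (cases "f p") auto
  also have "\<dots> \<le> legendre f y" unfolding legendre_def by (rule SUP_upper) simp
  finally show ?thesis using MInf by simp
qed

lemma AE_not_frontier_convex:
  "convex S \<Longrightarrow> AE x in lborel. x \<notin> frontier (S :: 'a::euclidean_space set)"
  using negligible_convex_frontier[of S]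
  by (intro AE_not_in) (simp add: negligible_iff_null_sets null_sets_completion_iff)

text \<open>
  Epi-limits of normalized functions stay in the class. Pointwise convergence fails only on the
  frontier of a convex set, which is null; the common majorant then gives dominated convergence of
  the integral and of the first moment. For the dual integrals, \<open>epi_converges_legendre\<close> and
  Fatou's lemma give lower semicontinuity.
\<close>

lemma normalized_limit:
  fixes F :: "nat \<Rightarrow> real^'n \<Rightarrow> ereal"
  assumes ec: "epi_converges F f"
    and F: "\<And>k. F k \<in> Cvx_plus" "\<And>k. normalized (F k)" "\<And>k. centroid (F k) = 0"
  shows "f \<in> Cvx_plus" "centroid f = 0" "(\<lambda>k. exp_integral (F k)) \<longlonglongrightarrow> exp_integral f"
    "exp_integral (legendre f) \<le> liminf (\<lambda>k. exp_integral (legendre (F k)))"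
proof -
  note FD = Cvx_plusD[OF F(1)]
  have cv: "ereal_convex (F k)" for k by (rule FD)
  obtain p :: "real^'n" and r where r: "r > 0"
    and ball: "\<And>\<phi> z. ereal_convex \<phi> \<Longrightarrow> normalized \<phi> \<Longrightarrow> z \<in> ball p r \<Longrightarrow> \<phi> z \<le> 1"
    using normalized_ball by metis
  have s: "F k z \<le> ereal 1" if "z \<in> ball p r" for k z
    using ball[OF cv F(2) that] by (simp add: one_ereal_def)
  define a where "a = 1 / (real CARD('n) + 1)"
  define C where "C = 2 * (2::real) ^ CARD('n)"
  have a: "a > 0" by (simp add: a_def)
  have lbF: "ereal (a * norm x - C) \<le> F k x" for k x
    using F(2)[of k] by (simp add: normalized_def a_def C_def add.commute)
  have lbf: "ereal (a * norm x - C) \<le> f x" for x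
    by (rule epi_limit_ge[OF ec _ lbF]) (intro continuous_intros)
  have ninf: "f x \<noteq> -\<infinity>" for x using lbf[of x] by auto
  have fs: "f z \<le> ereal 1" if "z \<in> ball p r" for z
    by (rule epi_limit_le[OF ec s[OF that]])
  have "p \<in> ball p r" using r by simp
  have fcv: "ereal_convex f" by (rule epi_limit_convex[OF ec cv ninf])
  have flsc: "lower_semicontinuous f" by (rule epi_limit_lsc[OF ec])
  have [measurable]: "f \<in> borel_measurable borel" "F k \<in> borel_measurable borel" for k
    by (rule lsc_measurable[OF flsc]) (rule FD)
  have "proper_fun f" using ninf fs[OF \<open>p \<in> ball p r\<close>] by (auto simp: proper_fun_def intro!: exI[of _ p])
  then have fC: "f \<in> Cvx" using fcv flsc by (simp add: Cvx_def)

  have conv: "AE x in lborel. (\<lambda>k. F k x) \<longlonglongrightarrow> f x"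
    using AE_not_frontier_convex[OF ereal_convex_domain[OF fcv]]
    by eventually_elim (rule epi_converges_pointwise[OF ec cv r s])
  define w where "w = (\<lambda>x::real^'n. exp C * exp (- a * norm x))"
  have wi: "integrable lborel w"
    unfolding w_def by (intro integrable_mult_right integrable_exp_norm a)
  have bound: "exp_neg (\<phi> x) \<le> ennreal (w x)" if "ereal (a * norm x - C) \<le> \<phi> x" for \<phi> and x :: "real^'n"
    using exp_neg_le_real[OF that] by (simp add: w_def exp_add[symmetric])
  have [measurable]: "w \<in> borel_measurable borel" using wi by simp
  have wfin: "(\<integral>\<^sup>+x. ennreal (w x) \<partial>lborel) < \<infinity>"
    using wi by (subst nn_integral_eq_integral) (auto simp: w_def)
  show lim: "(\<lambda>k. exp_integral (F k)) \<longlonglongrightarrow> exp_integral f"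
    unfolding exp_integral_def
  proof (rule nn_integral_dominated_convergence[OF _ _ _ _ wfin])
    show "AE x in lborel. (\<lambda>k. exp_neg (F k x)) \<longlonglongrightarrow> exp_neg (f x)"
      using conv by eventually_elim (rule tendsto_exp_neg)
  qed (use bound lbF in auto)
  have "exp_integral f \<le> (\<integral>\<^sup>+x. ennreal (w x) \<partial>lborel)"
    unfolding exp_integral_def by (intro nn_integral_mono bound lbf)
  then have fin: "exp_integral f < \<infinity>" using wfin by (rule le_less_trans)
  have "0 < ennreal (exp (- 1)) * emeasure lborel (ball p r)"
    using r by (simp add: ennreal_zero_less_mult_iff emeasure_ball unit_ball_vol_pos)
  also have "\<dots> = (\<integral>\<^sup>+x. ennreal (exp (- 1)) * indicator (ball p r) x \<partial>lborel)"
    by (simp add: nn_integral_cmult_indicator)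
  also have "\<dots> \<le> exp_integral f"
    unfolding exp_integral_def
  proof (rule nn_integral_mono)
    fix x
    show "ennreal (exp (- 1)) * indicator (ball p r) x \<le> exp_neg (f x)"
      using exp_neg_antimono[OF fs[of x]] by (cases "x \<in> ball p r") auto
  qed
  finally have pos: "0 < exp_integral f" .
  show fP: "f \<in> Cvx_plus" using fC pos fin by (simp add: Cvx_plus_def)

  have "(\<lambda>k. \<integral>x. density_fun (F k) x *\<^sub>R x \<partial>lborel) \<longlonglongrightarrow> (\<integral>x. density_fun f x *\<^sub>R x \<partial>lborel)"
  proof (rule integral_dominated_convergence)
    show "integrable lborel (\<lambda>x::real^'n. exp C * (2 / a * exp (- (a / 2) * norm x)))"
      using a by (intro integrable_mult_right integrable_exp_norm) auto
    show "AE x in lborel. norm (density_fun (F k) x *\<^sub>R x) \<le> exp C * (2 / a * exp (- (a / 2) * norm x))" for k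
    proof (rule AE_I2)
      fix x :: "real^'n"
      have "norm (density_fun (F k) x *\<^sub>R x) \<le> exp (- (a * norm x - C)) * norm x"
        using density_fun_le[where \<phi> = "F k" and x = x, OF lbF] by (simp add: mult_right_mono)
      also have "\<dots> = exp C * (norm x * exp (- a * norm x))" by (simp add: exp_diff exp_minus field_simps)
      also have "\<dots> \<le> exp C * (2 / a * exp (- (a / 2) * norm x))"
        using norm_mult_exp_le[OF a, of x] by (intro mult_left_mono) auto
      finally show "norm (density_fun (F k) x *\<^sub>R x) \<le> exp C * (2 / a * exp (- (a / 2) * norm x))" .
    qed
    show "AE x in lborel. (\<lambda>k. density_fun (F k) x *\<^sub>R x) \<longlonglongrightarrow> density_fun f x *\<^sub>R x"
      using conv
    proof eventually_elim
      case (elim x)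
      have "(\<lambda>k. density_fun (F k) x) \<longlonglongrightarrow> density_fun f x"
        unfolding density_fun_def[of "F _"]
        by (rule tendsto_enn2real) (use tendsto_exp_neg[OF elim] in \<open>simp_all add: ennreal_density_fun ninf\<close>)
      then show ?case by (rule tendsto_scaleR) simp
    qed
  qed measurable
  moreover have "(\<integral>x. density_fun (F k) x *\<^sub>R x \<partial>lborel) = 0" for k
    using F(3)[of k] by (simp only: centroid_eq_0_iff[OF F(1)])
  ultimately have "(\<lambda>k::nat. 0) \<longlonglongrightarrow> (\<integral>x. density_fun f x *\<^sub>R x \<partial>lborel)" by simp
  then have "(\<integral>x. density_fun f x *\<^sub>R x \<partial>lborel) = 0" by (simp add: LIMSEQ_const_iff)
  then show "centroid f = 0" by (simp only: centroid_eq_0_iff[OF fP])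

  have [measurable]: "legendre g \<in> borel_measurable borel" for g :: "real^'n \<Rightarrow> ereal"
    by (rule lsc_measurable[OF legendre_lsc])
  have "exp_integral (legendre f) \<le> (\<integral>\<^sup>+y. liminf (\<lambda>k. exp_neg (legendre (F k) y)) \<partial>lborel)"
    unfolding exp_integral_def
  proof (rule nn_integral_mono_AE)
    show "AE y in lborel. exp_neg (legendre f y) \<le> liminf (\<lambda>k. exp_neg (legendre (F k) y))"
      using AE_not_frontier_convex[OF legendre_domain_convex[of f]]
      by eventually_elim (rule exp_neg_legendre_le_liminf[OF ec cv s[OF \<open>p \<in> ball p r\<close>]])
  qed
  also have "\<dots> \<le> liminf (\<lambda>k. exp_integral (legendre (F k)))"
    unfolding exp_integral_def by (rule nn_integral_liminf) measurable
  finally show "exp_integral (legendre f) \<le> liminf (\<lambda>k. exp_integral (legendre (F k)))" .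
qed

text \<open>
  The direct method, for an arbitrary class of centred functions that is closed under the
  symmetries and under epi-limits. The dual integrals of a minimizing sequence need not be bounded
  a priori; they converge in \<open>[0, \<infinity>]\<close> along a subsequence, and the product still
  converges because the limit of the other factor is neither \<open>0\<close> nor \<open>\<infinity>\<close>.
\<close>

lemma attains_min_P_legendre:
  fixes S :: "(real^'n \<Rightarrow> ereal) set"
  assumes ne: "S \<noteq> {}"
    and sub: "\<And>\<phi>. \<phi> \<in> S \<Longrightarrow> \<phi> \<in> Cvx_plus \<and> centroid \<phi> = 0"
    and aff: "\<And>\<phi> A c. \<phi> \<in> S \<Longrightarrow> invertible A \<Longrightarrow> affine_change A c \<phi> \<in> S"
    and lim: "\<And>F f. (\<And>k::nat. F k \<in> S) \<Longrightarrow> epi_converges F f \<Longrightarrow> f \<in> Cvx_plus \<Longrightarrow> centroid f = 0 \<Longrightarrow> f \<in> S"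
  shows "attains_min_on P_legendre S"
proof -
  define v where "v = Inf (P_legendre ` S)"
  obtain u where u: "\<And>k::nat. u k \<in> P_legendre ` S" "u \<longlonglongrightarrow> v"
    using Inf_as_limit[of "P_legendre ` S"] ne unfolding v_def by blast
  have "\<exists>\<psi>\<in>S. normalized \<psi> \<and> P_legendre \<psi> = u k" for k
  proof -
    obtain \<phi> where \<phi>: "\<phi> \<in> S" "u k = P_legendre \<phi>" using u(1)[of k] by blast
    then have C: "\<phi> \<in> Cvx_plus" "centroid \<phi> = 0" using sub by auto
    obtain A c where A: "invertible A" "normalized (affine_change A c \<phi>)"
      using normalized_affine_change[OF C] .
    have "P_legendre (affine_change A c \<phi>) = u k"
      using P_legendre_affine_change[OF A(1), of \<phi> c] C(1) \<phi>(2) by (simp add: Cvx_plusD)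
    then show ?thesis using A aff[OF \<phi>(1) A(1)] by blast
  qed
  then have "\<exists>F. \<forall>k. F k \<in> S \<and> normalized (F k) \<and> P_legendre (F k) = u k"
    by (intro choice allI) blast
  then obtain F where F: "\<And>k. F k \<in> S" "\<And>k. normalized (F k)" "\<And>k. P_legendre (F k) = u k"
    by blast
  obtain J r1 where r1: "strict_mono r1" "((\<lambda>k. exp_integral (legendre (F k))) \<circ> r1) \<longlonglongrightarrow> J"
    using compact_complete_linorder by blast
  obtain r2 f where r2: "strict_mono r2" "epi_converges ((F \<circ> r1) \<circ> r2) f"
    using epi_compactness .
  define G where "G = (F \<circ> r1) \<circ> r2"
  have ec: "epi_converges G f" using r2(2) by (simp add: G_def)
  have G: "G k \<in> S" "normalized (G k)" for k by (auto simp: G_def F)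
  have G': "G k \<in> Cvx_plus" "centroid (G k) = 0" for k using sub[OF G(1)] by auto
  note lims = normalized_limit[OF ec G'(1) G(2) G'(2)]
  have fS: "f \<in> S" by (rule lim[OF G(1) ec lims(1,2)])
  have J: "(\<lambda>k. exp_integral (legendre (G k))) \<longlonglongrightarrow> J"
    using LIMSEQ_subseq_LIMSEQ[OF r1(2) r2(1)] by (simp add: G_def o_def)
  then have leJ: "exp_integral (legendre f) \<le> J"
    using lims(4) lim_imp_Liminf[OF sequentially_bot J] by simp
  have "(\<lambda>k. exp_integral (G k) * exp_integral (legendre (G k))) \<longlonglongrightarrow> exp_integral f * J"
    by (rule tendsto_mult_ennreal[OF lims(3) J]) (use Cvx_plusD(5,6)[OF lims(1)] in auto)
  moreover have "(\<lambda>k. exp_integral (G k) * exp_integral (legendre (G k))) = (u \<circ> r1) \<circ> r2"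
    using F(3) by (simp add: G_def P_legendre_def fun_eq_iff)
  moreover have "((u \<circ> r1) \<circ> r2) \<longlonglongrightarrow> v"
    by (intro LIMSEQ_subseq_LIMSEQ u r1 r2)
  ultimately have "exp_integral f * J = v" by (metis LIMSEQ_unique)
  then have "P_legendre f \<le> v"
    unfolding P_legendre_def using leJ by (metis mult_left_mono zero_le)
  then have "P_legendre f \<le> P_legendre \<phi>" if "\<phi> \<in> S" for \<phi>
    using that Inf_lower[of "P_legendre \<phi>" "P_legendre ` S"] unfolding v_def by (meson imageI order_trans)
  then show ?thesis unfolding attains_min_on_def using fS by blast
qed

lemma ball_indicator_Cvx_plus:
  fixes \<phi> :: "real^'n \<Rightarrow> ereal"
  defines "\<phi> \<equiv> \<lambda>x. if norm x \<le> 1 then 0 else \<infinity>"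
  shows "\<phi> \<in> Cvx_plus" "even_fun \<phi>"
proof -
  have "open {x. t < \<phi> x}" for t
  proof (cases "t < 0")
    case True
    then have "{x. t < \<phi> x} = UNIV" by (auto simp: \<phi>_def intro: less_trans)
    then show ?thesis by simp
  next
    case False
    then have "{x. t < \<phi> x} = (if t < \<infinity> then - cball 0 1 else {})" by (auto simp: \<phi>_def)
    then show ?thesis by (simp add: open_Compl)
  qed
  then have 1: "lower_semicontinuous \<phi>" by (simp add: lsc_iff_open)
  have 2: "proper_fun \<phi>" by (auto simp: proper_fun_def \<phi>_def intro: exI[of _ 0])
  have 3: "ereal_convex \<phi>"
  proof (rule ereal_convexI)
    fix x y :: "real^'n" and s t u v :: real
    assume st: "\<phi> x < ereal s" "\<phi> y < ereal t" and uv: "u > 0" "v > 0" "u + v = 1"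
    then have n: "norm x \<le> 1" "norm y \<le> 1" "0 < s" "0 < t" by (auto simp: \<phi>_def split: if_splits)
    then have "u *\<^sub>R x + v *\<^sub>R y \<in> cball 0 1"
      by (intro convexD[OF convex_cball]) (use uv in auto)
    moreover have "0 \<le> u * s + v * t" using n uv by simp
    ultimately show "\<phi> (u *\<^sub>R x + v *\<^sub>R y) \<le> ereal (u * s + v * t)" by (simp add: \<phi>_def)
  qed (auto simp: \<phi>_def)
  have "exp_neg (\<phi> x) = indicator (cball 0 1) x" for x
    by (auto simp: \<phi>_def zero_ereal_def)
  then have "exp_integral \<phi> = emeasure lborel (cball 0 1 :: (real^'n) set)"
    by (simp add: exp_integral_def)
  also have "\<dots> = ennreal (unit_ball_vol (real CARD('n)))" by (simp add: emeasure_cball)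
  finally have "exp_integral \<phi> = ennreal (unit_ball_vol (real CARD('n)))" .
  then show "\<phi> \<in> Cvx_plus" using 1 2 3 by (simp add: Cvx_plus_def Cvx_def unit_ball_vol_pos)
  show "even_fun \<phi>" by (simp add: even_fun_def \<phi>_def)
qed

theorem theorem1p2:
  shows "attains_min_on P_legendre {\<phi> :: real ^ 'n::finite \<Rightarrow> ereal. \<phi> \<in> Cvx_plus \<and> even_fun \<phi>}
       \<and> attains_min_on P_legendre {\<phi> :: real ^ 'n::finite \<Rightarrow> ereal. \<phi> \<in> Cvx_plus \<and> centroid \<phi> = 0}"
proof
  show "attains_min_on P_legendre {\<phi> :: real ^ 'n::finite \<Rightarrow> ereal. \<phi> \<in> Cvx_plus \<and> even_fun \<phi>}"
  proof (rule attains_min_P_legendre)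
    show "{\<phi> :: real ^ 'n \<Rightarrow> ereal. \<phi> \<in> Cvx_plus \<and> even_fun \<phi>} \<noteq> {}"
      using ball_indicator_Cvx_plus by blast
  qed (auto intro: even_centroid affine_change_Cvx_plus affine_change_even epi_limit_even)
  show "attains_min_on P_legendre {\<phi> :: real ^ 'n::finite \<Rightarrow> ereal. \<phi> \<in> Cvx_plus \<and> centroid \<phi> = 0}"
  proof (rule attains_min_P_legendre)
    show "{\<phi> :: real ^ 'n \<Rightarrow> ereal. \<phi> \<in> Cvx_plus \<and> centroid \<phi> = 0} \<noteq> {}"
      using ball_indicator_Cvx_plus even_centroid by blast
  qed (auto intro: affine_change_Cvx_plus affine_change_centroid)
qed

end
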